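(* The primitive part of $\hat{\mathcal B}_n^{\mathfrak S_\bullet}$ is left pointwise fixed under the action of the automorphism group $\mathrm{Aut}(\mathbf P)$ of the projective line $\mathbf P$.
   Context: $\mathbf P$ is the complex projective line, $\infty\in\mathbf P$, $\mathbf A=\mathbf P-\{\infty\}$ with an affine coordinate. $\mathcal I$ is a countable set with a surjection $\pi:\mathcal I\to\{1,\dots,r\}$ with infinite fibers $\mathcal I_k$; $\mathfrak S_\bullet=\prod_k\mathfrak S(\mathcal I_k)$. Polydifferentials in the variables $t_i$ ($i\in\mathcal I$, each ranging over $\mathbf P$) are like differential forms except that the $dt_i$ commute, with $dt_i^2=0$. For a sequence $I=(i_N,\dots,i_1)$ in $\mathcal I$ without repetition, $\zeta_I(z)=\frac{dt_{i_N}\cdots dt_{i_1}}{(t_{i_N}-t_{i_{N-1}})\cdots(t_{i_2}-t_{i_1})(t_{i_1}-z)}$; $\zeta_\emptyset=1$; $\zeta_I=0$ if $I$ has a repetition. Let $n\ge1$. For an $n$-tuple $(I^1,\dots,I^n)$ of finite sequences in $\mathcal I$ consider the relative polydifferential $\zeta_{I^1}(z_1)\cdots\zeta_{I^n}(z_n)$ depending rationally on $(z_1,\dots,z_n)$. $\hat{\mathcal B}_n=\bigoplus_d\hat{\mathcal B}_n^d$, where $\hat{\mathcal B}_n^d$ consists of the possibly infinite complex linear combinations of such expressions of degree $d=\sum|I^\nu|$. The space of invariants $\hat{\mathcal B}_n^{\mathfrak S_\bullet}$ has as basis the elements $\zeta(S^1,\dots,S^n)=\sum\zeta_{I^1}(z_1)\cdots\zeta_{I^n}(z_n)$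 (sum over the tuples with $\pi(I^\nu)=S^\nu$), indexed by $n$-tuples of finite sequences in $\{1,\dots,r\}$. Operators $\tilde e_k=\sum_\nu\tilde e_k^{(\nu)}$ are defined by $\tilde e_k^{(\nu)}\zeta(S^1,\dots,S^n)=\zeta(S^1,\dots,S',\dots,S^n)$ (in the $\nu$-th place) if $S^\nu=kS'$, and $0$ otherwise. The primitive part is the subspace killed by all $\tilde e_1,\dots,\tilde e_r$; equivalently the subspace of polydifferentials regular along every hyperplane $(t_i=\infty)$, $i\in\mathcal I$. $\mathrm{Aut}(\mathbf P)$ acts diagonally on $\mathbf P^{\mathcal I}\times\mathbf P^n$ (coordinates $(t_i)_{i\in\mathcal I}$, $(z_1,\dots,z_n)$), compatibly with the projection to $\mathbf P^n$, hence acts by pull-back on rational relative polydifferentials. *)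

theory Defs
  imports
    Complex_Main
    "HOL-Library.Poly_Mapping"
    "HOL-Library.Countable"
    "HOL-Library.Disjoint_Sets"
    "HOL-Library.Function_Algebras"
    "HOL-Computational_Algebra.Polynomial"
    "HOL-Computational_Algebra.Polynomial_Factorial"
    "HOL-Computational_Algebra.Fraction_Field"
begin

section \<open>Rational functions on \<open>\<^bold>P\<^sup>I \<times> \<^bold>P\<^sup>n\<close>\<close>

text \<open>
  The index set of the variables \<open>t\<^sub>i\<close> is a countable type \<open>'i\<close>, that of the variables
  \<open>z\<^sub>\<nu>\<close> is a finite type \<open>'n\<close> with \<open>n\<close> elements (so \<open>n \<ge> 1\<close>).
\<close>

datatype ('i, 'n) pvar = T 'i | Z 'n

instance pvar :: (countable, countable) countable
  by countable_datatype

text \<open>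
  An arbitrary linear order on the variables. It has no mathematical meaning here: the
  library derives that \<open>Poly_Mapping\<close> polynomials form an integral domain (hence have a
  field of fractions) only for linearly ordered monomials.
\<close>

instantiation pvar :: (countable, countable) linorder
begin

definition less_eq_pvar :: "('a, 'b) pvar \<Rightarrow> ('a, 'b) pvar \<Rightarrow> bool"
  where "less_eq_pvar x y \<longleftrightarrow> to_nat x \<le> to_nat y"

definition less_pvar :: "('a, 'b) pvar \<Rightarrow> ('a, 'b) pvar \<Rightarrow> bool"
  where "less_pvar x y \<longleftrightarrow> to_nat x < to_nat y"

instance
  by intro_classes (auto simp: less_eq_pvar_def less_pvar_def)

end

type_synonym ('i, 'n) polyfun = "(('i, 'n) pvar \<Rightarrow>\<^sub>0 nat) \<Rightarrow>\<^sub>0 complex"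

type_synonym ('i, 'n) ratfun = "('i, 'n) polyfun fract"

definition const :: "complex \<Rightarrow> ('i::countable, 'n::finite) ratfun"
  where "const c = Fract (Poly_Mapping.single 0 c) 1"

definition var :: "('i::countable, 'n::finite) pvar \<Rightarrow> ('i, 'n) ratfun"
  where "var v = Fract (Poly_Mapping.single (Poly_Mapping.single v 1) 1) 1"

definition eval_polyfun ::
  "(('i, 'n) pvar \<Rightarrow> ('i::countable, 'n::finite) ratfun) \<Rightarrow> ('i, 'n) polyfun \<Rightarrow> ('i, 'n) ratfun"
  where "eval_polyfun \<theta> P =
    (\<Sum>m\<in>Poly_Mapping.keys P. const (Poly_Mapping.lookup P m) *
       (\<Prod>v\<in>Poly_Mapping.keys m. \<theta> v ^ Poly_Mapping.lookup m v))"

text \<open>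
  Substitution of \<open>\<theta> v\<close> for each variable \<open>v\<close>. The value does not depend on the chosen
  fraction, and such a fraction exists for every \<open>f\<close> if the \<open>\<theta> v\<close> are algebraically
  independent over the complex numbers, as in all uses below.
\<close>

definition subst ::
  "(('i, 'n) pvar \<Rightarrow> ('i::countable, 'n::finite) ratfun) \<Rightarrow> ('i, 'n) ratfun \<Rightarrow> ('i, 'n) ratfun"
  where "subst \<theta> f =
    (THE u. \<exists>P Q. f = Fract P Q \<and> eval_polyfun \<theta> Q \<noteq> 0 \<and> u = eval_polyfun \<theta> P / eval_polyfun \<theta> Q)"


section \<open>Relative polydifferentials\<close>

text \<open>
  A (possibly infinite) sum \<open>\<Sum>\<^sub>J f\<^sub>J \<Prod>\<^sub>i\<^sub>\<in>\<^sub>J dt\<^sub>i\<close> over the finite subsets \<open>J\<close> of the index set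
  is represented by its coefficient function \<open>J \<mapsto> f\<^sub>J\<close>; this encodes that the \<open>dt\<^sub>i\<close> commute
  and have square zero. All polydifferentials introduced below vanish on infinite \<open>J\<close>.
\<close>

type_synonym ('i, 'n) polydiff = "'i set \<Rightarrow> ('i, 'n) ratfun"

definition scale ::
  "complex \<Rightarrow> ('i::countable, 'n::finite) polydiff \<Rightarrow> ('i, 'n) polydiff"
  where "scale c \<omega> = (\<lambda>J. const c * \<omega> J)"

lemma const_add: "const (a + b) = const a + const b"
  by (simp add: const_def single_add)

lemma const_mult: "const (a * b) = const a * const b"
  by (simp add: const_def mult_single)

lemma const_1: "const 1 = 1"
  by (simp add: const_def One_fract_def)

interpretation polydiff: vector_space scale
  by standard
    (simp_all add: scale_def fun_eq_iff const_add const_mult const_1 algebra_simps)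

text \<open>
  The product \<open>\<Prod>\<^sub>\<nu> \<alpha>\<^sub>\<nu>\<close>: as \<open>dt\<^sub>i\<^sup>2 = 0\<close>, only pairwise disjoint index sets contribute.
\<close>

definition polydiff_prod ::
  "('n \<Rightarrow> ('i::countable, 'n::finite) polydiff) \<Rightarrow> ('i, 'n) polydiff"
  where "polydiff_prod \<alpha> =
    (\<lambda>J. \<Sum>A | disjoint_family A \<and> (\<Union>\<nu>. A \<nu>) = J. \<Prod>\<nu>\<in>UNIV. \<alpha> \<nu> (A \<nu>))"

text \<open>
  The sequence \<open>(i\<^sub>N, \<dots>, i\<^sub>1)\<close> is the list \<open>[i\<^sub>N, \<dots>, i\<^sub>1]\<close>; its last entry is linked to \<open>z\<^sub>\<nu>\<close>.
\<close>

fun zeta_denom :: "'n \<Rightarrow> 'i list \<Rightarrow> ('i::countable, 'n::finite) ratfun"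
  where
    "zeta_denom \<nu> [] = 1"
  | "zeta_denom \<nu> [i] = var (T i) - var (Z \<nu>)"
  | "zeta_denom \<nu> (i # j # I) = (var (T i) - var (T j)) * zeta_denom \<nu> (j # I)"

definition zeta_seq :: "'n \<Rightarrow> 'i list \<Rightarrow> ('i::countable, 'n::finite) polydiff"
  where "zeta_seq \<nu> I = (\<lambda>J. if distinct I \<and> J = set I then 1 / zeta_denom \<nu> I else 0)"

definition zeta_tuple :: "('n \<Rightarrow> 'i list) \<Rightarrow> ('i::countable, 'n::finite) polydiff"
  where "zeta_tuple I = polydiff_prod (\<lambda>\<nu>. zeta_seq \<nu> (I \<nu>))"

text \<open>
  Infinite linear combinations are summed coefficientwise: on a given \<open>J\<close> only finitely many
  \<open>zeta_tuple I\<close> are nonzero, so that \<open>Sum_any\<close> is a genuine finite sum.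
\<close>

definition Bhat_deg :: "nat \<Rightarrow> ('i::countable, 'n::finite) polydiff set"
  where "Bhat_deg d = {\<omega>. \<exists>c :: ('n \<Rightarrow> 'i list) \<Rightarrow> complex.
    (\<forall>I. c I \<noteq> 0 \<longrightarrow> (\<Sum>\<nu>\<in>UNIV. length (I \<nu>)) = d) \<and>
    \<omega> = (\<lambda>J. Sum_any (\<lambda>I. const (c I) * zeta_tuple I J))}"

definition Bhat :: "('i::countable, 'n::finite) polydiff set"
  where "Bhat = polydiff.span (\<Union>d. Bhat_deg d)"


section \<open>Invariants and the primitive part\<close>

text \<open>In this section \<open>\<pi>\<close> maps the index set to the type \<open>'k\<close>, which stands for \<open>{1, \<dots>, r}\<close>.\<close>

definition color_perms :: "('i \<Rightarrow> 'k) \<Rightarrow> ('i \<Rightarrow> 'i) set"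
  where "color_perms \<pi> = {\<sigma>. bij \<sigma> \<and> (\<forall>i. \<pi> (\<sigma> i) = \<pi> i)}"

text \<open>The action induced by \<open>t\<^sub>i \<mapsto> t\<^sub>\<sigma>\<^sub>(\<^sub>i\<^sub>)\<close> and \<open>dt\<^sub>i \<mapsto> dt\<^sub>\<sigma>\<^sub>(\<^sub>i\<^sub>)\<close>.\<close>

definition permute ::
  "('i \<Rightarrow> 'i) \<Rightarrow> ('i::countable, 'n::finite) polydiff \<Rightarrow> ('i, 'n) polydiff"
  where "permute \<sigma> \<omega> =
    (\<lambda>J. subst (\<lambda>v. var (case v of T i \<Rightarrow> T (\<sigma> i) | Z \<nu> \<Rightarrow> Z \<nu>)) (\<omega> (inv \<sigma> ` J)))"

definition Bhat_invariants :: "('i \<Rightarrow> 'k) \<Rightarrow> ('i::countable, 'n::finite) polydiff set"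
  where "Bhat_invariants \<pi> = {\<omega> \<in> Bhat. \<forall>\<sigma>\<in>color_perms \<pi>. permute \<sigma> \<omega> = \<omega>}"

definition zeta :: "('i \<Rightarrow> 'k) \<Rightarrow> ('n \<Rightarrow> 'k list) \<Rightarrow> ('i::countable, 'n::finite) polydiff"
  where "zeta \<pi> S =
    (\<lambda>J. Sum_any (\<lambda>I. if \<forall>\<nu>. map \<pi> (I \<nu>) = S \<nu> then zeta_tuple I J else 0))"

definition e_basis ::
  "('i \<Rightarrow> 'k) \<Rightarrow> 'k \<Rightarrow> 'n \<Rightarrow> ('n \<Rightarrow> 'k list) \<Rightarrow> ('i::countable, 'n::finite) polydiff"
  where "e_basis \<pi> k \<nu> S =
    (case S \<nu> of [] \<Rightarrow> 0 | l # S' \<Rightarrow> if l = k then zeta \<pi> (S(\<nu> := S')) else 0)"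

text \<open>
  The linear extension from the basis \<open>zeta \<pi> S\<close> of the space of invariants;
  \<open>polydiff.representation B \<omega> b\<close> is the coefficient of \<open>\<omega>\<close> at the basis element \<open>b\<close>.
\<close>

definition e_comp ::
  "('i \<Rightarrow> 'k) \<Rightarrow> 'k \<Rightarrow> 'n \<Rightarrow> ('i::countable, 'n::finite) polydiff \<Rightarrow> ('i, 'n) polydiff"
  where "e_comp \<pi> k \<nu> \<omega> =
    Sum_any (\<lambda>S. scale (polydiff.representation (range (zeta \<pi>)) \<omega> (zeta \<pi> S)) (e_basis \<pi> k \<nu> S))"

definition e_op ::
  "('i \<Rightarrow> 'k) \<Rightarrow> 'k \<Rightarrow> ('i::countable, 'n::finite) polydiff \<Rightarrow> ('i, 'n) polydiff"
  where "e_op \<pi> k \<omega> = (\<Sum>\<nu>\<in>UNIV. e_comp \<pi> k \<nu> \<omega>)"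

definition primitive_part :: "('i \<Rightarrow> 'k) \<Rightarrow> ('i::countable, 'n::finite) polydiff set"
  where "primitive_part \<pi> = {\<omega> \<in> Bhat_invariants \<pi>. \<forall>k. e_op \<pi> k \<omega> = 0}"


section \<open>The projective line and its automorphisms\<close>

datatype proj_line = Aff complex | Infty

definition proj_point :: "complex \<Rightarrow> complex \<Rightarrow> proj_line"
  where "proj_point a b = (if b = 0 then Infty else Aff (a / b))"

text \<open>
  The morphism \<open>p / q\<close> for coprime \<open>p\<close> and \<open>q\<close>. In homogeneous coordinates it is given by
  the homogenizations of \<open>p\<close> and \<open>q\<close> of degree \<open>m\<close>, whose values at \<open>\<infinity> = [1 : 0]\<close> are the
  coefficients in degree \<open>m\<close>.
\<close>

definition rat_map :: "complex poly \<Rightarrow> complex poly \<Rightarrow> proj_line \<Rightarrow> proj_line"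
  where "rat_map p q x = (case x of
      Aff a \<Rightarrow> proj_point (poly p a) (poly q a)
    | Infty \<Rightarrow> (let m = max (degree p) (degree q) in proj_point (coeff p m) (coeff q m)))"

definition proj_morphism :: "(proj_line \<Rightarrow> proj_line) \<Rightarrow> bool"
  where "proj_morphism g \<longleftrightarrow> (\<exists>p q. coprime p q \<and> g = rat_map p q)"

definition Aut_P :: "(proj_line \<Rightarrow> proj_line) set"
  where "Aut_P = {g. bij g \<and> proj_morphism g \<and> proj_morphism (inv g)}"

text \<open>The pair \<open>(p, q)\<close> is unique up to a common scalar, which cancels in what follows.\<close>

definition morphism_rep :: "(proj_line \<Rightarrow> proj_line) \<Rightarrow> complex poly \<times> complex poly"
  where "morphism_rep g = (SOME (p, q). coprime p q \<and> g = rat_map p q)"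

definition eval_quot ::
  "complex poly \<Rightarrow> complex poly \<Rightarrow> ('i::countable, 'n::finite) ratfun \<Rightarrow> ('i, 'n) ratfun"
  where "eval_quot p q f = poly (map_poly const p) f / poly (map_poly const q) f"

definition morphism_at ::
  "(proj_line \<Rightarrow> proj_line) \<Rightarrow> ('i::countable, 'n::finite) ratfun \<Rightarrow> ('i, 'n) ratfun"
  where "morphism_at g f = (case morphism_rep g of (p, q) \<Rightarrow> eval_quot p q f)"

definition morphism_deriv_at ::
  "(proj_line \<Rightarrow> proj_line) \<Rightarrow> ('i::countable, 'n::finite) ratfun \<Rightarrow> ('i, 'n) ratfun"
  where "morphism_deriv_at g f =
    (case morphism_rep g of (p, q) \<Rightarrow> eval_quot (pderiv p * q - p * pderiv q) (q ^ 2) f)"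

text \<open>
  Pull-back along the diagonal action of \<open>g\<close>: \<open>t\<^sub>i \<mapsto> g(t\<^sub>i)\<close>, \<open>z\<^sub>\<nu> \<mapsto> g(z\<^sub>\<nu>)\<close> and
  \<open>dt\<^sub>i \<mapsto> g'(t\<^sub>i) dt\<^sub>i\<close>.
\<close>

definition pullback ::
  "(proj_line \<Rightarrow> proj_line) \<Rightarrow> ('i::countable, 'n::finite) polydiff \<Rightarrow> ('i, 'n) polydiff"
  where "pullback g \<omega> =
    (\<lambda>J. subst (\<lambda>v. morphism_at g (var v)) (\<omega> J) * (\<Prod>i\<in>J. morphism_deriv_at g (var (T i))))"

end

theory Submission
  imports Defs
    "HOL-Computational_Algebra.Fundamental_Theorem_Algebra"
    "HOL-Computational_Algebra.Field_as_Ring"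
    "HOL-Combinatorics.Transposition"
begin

text \<open>
  An automorphism of the projective line is a transformation \<open>g(t) = (a t + b) / (c t + d)\<close> with
  determinant \<open>D = a d - b c \<noteq> 0\<close>: a rational map \<open>p / q\<close> of higher degree is not injective,
  because then the polynomials \<open>p - l q\<close>, whose roots form the fibre over \<open>l\<close>, would have a
  multiple root for almost all \<open>l\<close>, whereas such a root is one of the finitely many zeros of the
  Wronskian of \<open>p\<close> and \<open>q\<close> (\<open>Aut_P_morphism_rep\<close>).

  Since \<open>g(s) - g(t) = D (s - t) / ((c s + d) (c t + d))\<close> and \<open>g'(t) = D / (c t + d)\<^sup>2\<close>, nearly
  everything cancels in the pull-back of \<open>\<zeta>\<^sub>I(z)\<close>: it is \<open>\<zeta>\<^sub>I(z)\<close> times \<open>(c z + d) / (c t + d)\<close>,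
  where \<open>t\<close> is the variable of the first entry of \<open>I\<close>, or \<open>z\<close> if \<open>I\<close> is empty
  (\<open>chain_mobius\<close>). A tuple \<open>I\<close> with first variables \<open>t\<^sub>\<nu>\<close> thus acquires the factor
  \<open>\<Prod>\<^sub>\<nu> (c z\<^sub>\<nu> + d) / (c t\<^sub>\<nu> + d)\<close>, which has the partial fraction expansion
  \<open>1 + \<Sum>\<^sub>\<nu> c (z\<^sub>\<nu> - t\<^sub>\<nu>) / (c t\<^sub>\<nu> + d) \<cdot> \<Prod>\<^sub>\<mu>\<^sub>\<noteq>\<^sub>\<nu> (z\<^sub>\<mu> - t\<^sub>\<nu>) / (t\<^sub>\<mu> - t\<^sub>\<nu>)\<close>
  (\<open>prod_mobius_partial_fractions\<close>). The term \<open>1\<close> reproduces the polydifferential. Each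
  remaining term belongs to a tuple \<open>I\<close> and a place \<open>\<nu>\<close> where \<open>I\<close> has a first entry \<open>i\<close>. Let \<open>K\<close>
  be the tuple obtained by deleting this entry, with first variables \<open>s\<^sub>\<mu>\<close>. Then \<open>t\<^sub>\<nu> = t\<^sub>i\<close>, and
  \<open>\<zeta>\<^sub>I = \<zeta>\<^sub>K / (t\<^sub>i - s\<^sub>\<nu>)\<close> supplies just the factor that completes the product over
  \<open>\<mu> \<noteq> \<nu>\<close> to the product of \<open>(z\<^sub>\<mu> - t\<^sub>i) / (s\<^sub>\<mu> - t\<^sub>i)\<close> over all \<open>\<mu>\<close>. So the term depends on
  \<open>\<nu>\<close> only through the coefficient of \<open>I\<close>, and for fixed \<open>i\<close> and \<open>K\<close> the sum over \<open>\<nu>\<close> is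
  zero as soon as the coefficients of the tuples that arise from \<open>K\<close> by putting \<open>i\<close> in front
  of one of its members add up to zero (\<open>primitive_sum_mobius_invariant\<close>).

  That is what primitivity says (\<open>primitive_part_coefficients\<close>), once the coordinates in which
  the operators are defined are known to be genuine. On a fixed index set \<open>J\<close>
  the \<open>\<zeta>\<^sub>I\<close> are linearly independent: taking the residue along \<open>t\<^sub>i = z\<^sub>\<nu>\<close> keeps only the tuples
  whose member at \<open>\<nu>\<close> ends with \<open>i\<close>, and deletes \<open>i\<close> from them, which allows an induction
  on \<open>J\<close> (\<open>tuple_values_independent\<close>). Hence the coefficients are determined, for an invariant
  element they depend only on the colours of the tuple because colour-preserving permutations
  connect any two tuples of the same colours, and the elements \<open>zeta \<pi> S\<close> are a basis.
\<close>


section \<open>Evaluating rational functions\<close>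

lemma const_0: "const 0 = 0"
  by (simp add: const_def Zero_fract_def)

lemma const_eq_iff: "const a = const b \<longleftrightarrow> a = b"
  by (simp add: const_def eq_fract inj_eq[OF inj_single])

lemma const_eq_0_iff: "const a = 0 \<longleftrightarrow> a = 0"
  using const_eq_iff[of a 0] by (simp add: const_0)

lemma const_uminus: "const (- a) = - const a"
  using const_add[of a "- a"] by (simp add: const_0 eq_neg_iff_add_eq_0 add.commute)

lemma const_diff: "const (a - b) = const a - const b"
  using const_add[of a "- b"] by (simp add: const_uminus)

lemma const_sum: "const (sum f A) = (\<Sum>x\<in>A. const (f x))"
  by (induction A rule: infinite_finite_induct) (simp_all add: const_0 const_add)

lemma var_eq_iff: "var u = var v \<longleftrightarrow> u = v"
  by (auto simp: var_def eq_fract dest!: arg_cong[where f = Poly_Mapping.keys])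

lemma inj_var: "inj var"
  by (simp add: inj_def var_eq_iff)

lemma var_neq_const: "var v \<noteq> const c"
proof
  assume "var v = const c"
  then have "Poly_Mapping.single (Poly_Mapping.single v (1::nat)) 1 = Poly_Mapping.single 0 c"
    by (simp add: var_def const_def eq_fract)
  then have "Poly_Mapping.keys (Poly_Mapping.single (Poly_Mapping.single v (1::nat)) (1::complex))
      = Poly_Mapping.keys (Poly_Mapping.single (0 :: _ \<Rightarrow>\<^sub>0 nat) c)"
    by simp
  then show False
    by (auto split: if_splits dest!: arg_cong[where f = Poly_Mapping.keys])
qed

definition eval_monom :: "('v \<Rightarrow> 'a::comm_monoid_mult) \<Rightarrow> ('v \<Rightarrow>\<^sub>0 nat) \<Rightarrow> 'a"
  where "eval_monom \<theta> m = (\<Prod>v\<in>Poly_Mapping.keys m. \<theta> v ^ Poly_Mapping.lookup m v)"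

lemma eval_monom_superset:
  assumes "finite A" "Poly_Mapping.keys m \<subseteq> A"
  shows "eval_monom \<theta> m = (\<Prod>v\<in>A. \<theta> v ^ Poly_Mapping.lookup m v)"
  unfolding eval_monom_def
  by (rule prod.mono_neutral_left) (use assms in \<open>auto simp: in_keys_iff\<close>)

lemma eval_monom_add: "eval_monom \<theta> (m + m') = eval_monom \<theta> m * eval_monom \<theta> m'"
proof -
  let ?A = "Poly_Mapping.keys m \<union> Poly_Mapping.keys m'"
  have "eval_monom \<theta> (m + m') = (\<Prod>v\<in>?A. \<theta> v ^ Poly_Mapping.lookup (m + m') v)"
    by (rule eval_monom_superset) (auto dest: subsetD[OF Poly_Mapping.keys_add])
  also have "\<dots> = eval_monom \<theta> m * eval_monom \<theta> m'"
    by (simp add: eval_monom_superset[of ?A] lookup_add power_add prod.distrib)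
  finally show ?thesis .
qed

lemma eval_polyfun_superset:
  assumes "finite A" "Poly_Mapping.keys P \<subseteq> A"
  shows "eval_polyfun \<theta> P = (\<Sum>m\<in>A. const (Poly_Mapping.lookup P m) * eval_monom \<theta> m)"
  unfolding eval_polyfun_def eval_monom_def[symmetric]
  by (rule sum.mono_neutral_left) (use assms in \<open>auto simp: in_keys_iff const_0\<close>)

lemma eval_polyfun_add: "eval_polyfun \<theta> (P + Q) = eval_polyfun \<theta> P + eval_polyfun \<theta> Q"
proof -
  let ?A = "Poly_Mapping.keys P \<union> Poly_Mapping.keys Q"
  have "eval_polyfun \<theta> (P + Q)
      = (\<Sum>m\<in>?A. const (Poly_Mapping.lookup (P + Q) m) * eval_monom \<theta> m)"
    by (rule eval_polyfun_superset) (auto dest: subsetD[OF Poly_Mapping.keys_add])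
  then show ?thesis
    by (simp add: eval_polyfun_superset[of ?A] lookup_add const_add distrib_right sum.distrib)
qed

lemma eval_polyfun_zero: "eval_polyfun \<theta> 0 = 0"
  by (simp add: eval_polyfun_def)

lemma eval_polyfun_single:
  "eval_polyfun \<theta> (Poly_Mapping.single m a) = const a * eval_monom \<theta> m"
  by (simp add: eval_polyfun_superset[of "{m}"])

lemma polyfun_induct [case_names zero add]:
  assumes "R 0" "\<And>P m a. R P \<Longrightarrow> R (P + Poly_Mapping.single m a)"
  shows "R (P :: 'b \<Rightarrow>\<^sub>0 'c::comm_monoid_add)"
proof (induction P rule: update_induct)
  case const
  then show ?case using assms(1) .
next
  case (update P m a)
  have "Poly_Mapping.update m a P = P + Poly_Mapping.single m a"
    using update.hyps
    by (intro poly_mapping_eqI) (auto simp: lookup_update lookup_add lookup_single in_keys_iff)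
  then show ?case
    using assms(2)[OF update.IH] by simp
qed

lemma eval_polyfun_mult: "eval_polyfun \<theta> (P * Q) = eval_polyfun \<theta> P * eval_polyfun \<theta> Q"
proof (induction P rule: polyfun_induct)
  case zero
  then show ?case by (simp add: eval_polyfun_zero)
next
  case (add P m a)
  have "eval_polyfun \<theta> (Poly_Mapping.single m a * Q)
      = eval_polyfun \<theta> (Poly_Mapping.single m a) * eval_polyfun \<theta> Q"
    by (induction Q rule: polyfun_induct)
      (simp_all add: eval_polyfun_zero eval_polyfun_add eval_polyfun_single mult_single
        eval_monom_add const_mult algebra_simps)
  then show ?case
    by (simp add: add.IH eval_polyfun_add distrib_right)
qed

lemma eval_polyfun_one: "eval_polyfun \<theta> 1 = 1"
proof -
  have "eval_polyfun \<theta> (Poly_Mapping.single 0 1) = 1"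
    by (simp only: eval_polyfun_single) (simp add: eval_monom_def const_1)
  then show ?thesis
    by simp
qed

text \<open>
  The relation underlying \<open>subst\<close>. Unlike the function it says whether the value is defined, so
  it can be followed through sums, products and inverses.
\<close>

definition evaluates ::
  "(('i, 'n) pvar \<Rightarrow> ('i::countable, 'n::finite) ratfun) \<Rightarrow> ('i, 'n) ratfun \<Rightarrow> ('i, 'n) ratfun \<Rightarrow> bool"
  where "evaluates \<theta> f u \<longleftrightarrow>
    (\<exists>P Q. f = Fract P Q \<and> eval_polyfun \<theta> Q \<noteq> 0 \<and> u = eval_polyfun \<theta> P / eval_polyfun \<theta> Q)"

text \<open>
  Two representations of \<open>f\<close> with admissible denominators have equal cross products, and evaluation
  of polynomials is a ring homomorphism.
\<close>

lemma evaluates_unique: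
  assumes "evaluates \<theta> f u" "evaluates \<theta> f v"
  shows "u = v"
proof -
  obtain P Q where PQ: "f = Fract P Q" "eval_polyfun \<theta> Q \<noteq> 0"
    "u = eval_polyfun \<theta> P / eval_polyfun \<theta> Q"
    using assms(1) by (auto simp: evaluates_def)
  obtain R S where RS: "f = Fract R S" "eval_polyfun \<theta> S \<noteq> 0"
    "v = eval_polyfun \<theta> R / eval_polyfun \<theta> S"
    using assms(2) by (auto simp: evaluates_def)
  have "Q \<noteq> 0" "S \<noteq> 0"
    using PQ(2) RS(2) by (auto simp: eval_polyfun_zero)
  then have "P * S = R * Q"
    using PQ(1) RS(1) by (simp add: eq_fract)
  then have "eval_polyfun \<theta> P * eval_polyfun \<theta> S = eval_polyfun \<theta> R * eval_polyfun \<theta> Q"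
    by (metis eval_polyfun_mult)
  then show ?thesis
    using PQ RS by (simp add: frac_eq_eq)
qed

lemma subst_eqI: "evaluates \<theta> f u \<Longrightarrow> subst \<theta> f = u"
  unfolding subst_def evaluates_def[symmetric] by (blast intro: evaluates_unique)

lemma evaluates_add:
  assumes "evaluates \<theta> f u" "evaluates \<theta> g v"
  shows "evaluates \<theta> (f + g) (u + v)"
proof -
  obtain P Q R S where *: "f = Fract P Q" "eval_polyfun \<theta> Q \<noteq> 0"
    "u = eval_polyfun \<theta> P / eval_polyfun \<theta> Q" "g = Fract R S" "eval_polyfun \<theta> S \<noteq> 0"
    "v = eval_polyfun \<theta> R / eval_polyfun \<theta> S"
    using assms unfolding evaluates_def by blast
  have "Q \<noteq> 0" "S \<noteq> 0"
    using *(2,5) by (auto simp: eval_polyfun_zero)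
  then have "f + g = Fract (P * S + R * Q) (Q * S)"
    using * by simp
  then show ?thesis
    unfolding evaluates_def using *
    by (intro exI[of _ "P * S + R * Q"] exI[of _ "Q * S"])
      (simp add: eval_polyfun_add eval_polyfun_mult add_frac_eq)
qed

lemma evaluates_mult:
  assumes "evaluates \<theta> f u" "evaluates \<theta> g v"
  shows "evaluates \<theta> (f * g) (u * v)"
proof -
  obtain P Q R S where *: "f = Fract P Q" "eval_polyfun \<theta> Q \<noteq> 0"
    "u = eval_polyfun \<theta> P / eval_polyfun \<theta> Q" "g = Fract R S" "eval_polyfun \<theta> S \<noteq> 0"
    "v = eval_polyfun \<theta> R / eval_polyfun \<theta> S"
    using assms unfolding evaluates_def by blast
  then show ?thesis
    unfolding evaluates_def
    by (intro exI[of _ "P * R"] exI[of _ "Q * S"]) (simp add: eval_polyfun_mult)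
qed

lemma evaluates_const: "evaluates \<theta> (const c) (const c)"
  unfolding evaluates_def const_def[of c, symmetric]
  by (intro exI[of _ "Poly_Mapping.single 0 c"] exI[of _ 1])
    (simp add: eval_polyfun_one eval_polyfun_single eval_monom_def const_def)

lemma evaluates_var: "evaluates \<theta> (var v) (\<theta> v)"
  unfolding evaluates_def
  by (intro exI[of _ "Poly_Mapping.single (Poly_Mapping.single v 1) 1"] exI[of _ 1])
    (simp add: eval_polyfun_one eval_polyfun_single eval_monom_def const_1 var_def)

lemma evaluates_0: "evaluates \<theta> 0 0"
  using evaluates_const[of \<theta> 0] by (simp add: const_0)

lemma evaluates_1: "evaluates \<theta> 1 1"
  using evaluates_const[of \<theta> 1] by (simp add: const_1)

lemma evaluates_diff:
  assumes "evaluates \<theta> f u" "evaluates \<theta> g v"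
  shows "evaluates \<theta> (f - g) (u - v)"
proof -
  have "evaluates \<theta> (f + const (-1) * g) (u + const (-1) * v)"
    by (intro evaluates_add evaluates_mult evaluates_const assms)
  then show ?thesis by (simp add: const_uminus const_1)
qed

lemma evaluates_inverse:
  assumes "evaluates \<theta> f u" "u \<noteq> 0"
  shows "evaluates \<theta> (1 / f) (1 / u)"
proof -
  obtain P Q where *: "f = Fract P Q" "eval_polyfun \<theta> Q \<noteq> 0"
    "u = eval_polyfun \<theta> P / eval_polyfun \<theta> Q"
    using assms(1) by (auto simp: evaluates_def)
  then show ?thesis
    unfolding evaluates_def using assms(2)
    by (intro exI[of _ Q] exI[of _ P]) (auto simp: One_fract_def)
qed

lemma evaluates_sum:
  "(\<And>x. x \<in> A \<Longrightarrow> evaluates \<theta> (f x) (u x)) \<Longrightarrow> evaluates \<theta> (sum f A) (sum u A)"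
  by (induction A rule: infinite_finite_induct) (auto intro: evaluates_0 evaluates_add)

lemma evaluates_prod:
  "(\<And>x. x \<in> A \<Longrightarrow> evaluates \<theta> (f x) (u x)) \<Longrightarrow> evaluates \<theta> (prod f A) (prod u A)"
  by (induction A rule: infinite_finite_induct) (auto intro: evaluates_1 evaluates_mult)

section \<open>Chains and tuples\<close>

text \<open>
  The denominator of \<open>\<zeta>\<^sub>I(z)\<close> for elements of an arbitrary field in place of the variables. The
  base point \<open>z\<close> is the successor of the last entry. Values in other fields or at
  transformed variables are needed both for residues and for pull-backs.
\<close>

fun chain_denom :: "'a::field \<Rightarrow> 'a list \<Rightarrow> 'a"
  where
    "chain_denom z [] = 1"
  | "chain_denom z (x # xs) = (x - hd (xs @ [z])) * chain_denom z xs"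

lemma chain_denom_snoc: "chain_denom z (xs @ [x]) = (x - z) * chain_denom x xs"
  by (induction xs) (auto simp: hd_append)

lemma chain_denom_neq_0_iff: "chain_denom z xs \<noteq> 0 \<longleftrightarrow> distinct_adj (xs @ [z])"
  by (induction xs) (auto simp: distinct_adj_Cons)

lemma distinct_imp_distinct_adj: "distinct xs \<Longrightarrow> distinct_adj xs"
  by (induction xs) (auto simp: distinct_adj_Cons)

lemma zeta_denom_eq: "zeta_denom \<nu> I = chain_denom (var (Z \<nu>)) (map (\<lambda>i. var (T i)) I)"
  by (induction \<nu> I rule: zeta_denom.induct) simp_all

text \<open>
  Here \<open>\<theta>\<close> assigns values to the variables; \<open>\<theta> = var\<close> gives the rational function itself.
\<close>

definition chain_value :: "(('i, 'n) pvar \<Rightarrow> 'a::field) \<Rightarrow> 'n \<Rightarrow> 'i list \<Rightarrow> 'a"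
  where "chain_value \<theta> \<nu> I = 1 / chain_denom (\<theta> (Z \<nu>)) (map (\<lambda>i. \<theta> (T i)) I)"

definition tuple_value :: "(('i, 'n::finite) pvar \<Rightarrow> 'a::field) \<Rightarrow> ('n \<Rightarrow> 'i list) \<Rightarrow> 'a"
  where "tuple_value \<theta> I = (\<Prod>\<nu>\<in>UNIV. chain_value \<theta> \<nu> (I \<nu>))"

text \<open>
  The tuples whose product of \<open>\<zeta>\<close>'s has a nonzero component on \<open>J\<close>: the entries of all members
  together are the elements of \<open>J\<close>, each once.
\<close>

definition tuples :: "'i set \<Rightarrow> ('n \<Rightarrow> 'i list) set"
  where "tuples J = {I. (\<forall>\<nu>. distinct (I \<nu>)) \<and> disjoint_family (\<lambda>\<nu>. set (I \<nu>)) \<and>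
    (\<Union>\<nu>. set (I \<nu>)) = J}"

lemma finite_tuples:
  assumes "finite J"
  shows "finite (tuples J :: ('n::finite \<Rightarrow> 'i list) set)"
proof (rule finite_subset)
  show "tuples J \<subseteq> {I :: 'n \<Rightarrow> 'i list. \<forall>\<nu>. I \<nu> \<in> {xs. set xs \<subseteq> J \<and> distinct xs}}"
    by (auto simp: tuples_def)
  have "finite {xs. set xs \<subseteq> J \<and> distinct xs}"
    using finite_subset_distinct[OF assms] by simp
  then have "finite (PiE UNIV (\<lambda>_::'n. {xs. set xs \<subseteq> J \<and> distinct xs}))"
    by (intro finite_PiE) auto
  then show "finite {I :: 'n \<Rightarrow> 'i list. \<forall>\<nu>. I \<nu> \<in> {xs. set xs \<subseteq> J \<and> distinct xs}}"
    by (simp add: PiE_UNIV_domain Pi_def)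
qed

lemma tuples_infinite: "infinite J \<Longrightarrow> (tuples J :: ('n::finite \<Rightarrow> 'i list) set) = {}"
  by (auto simp: tuples_def)

text \<open>
  Of all ways to distribute \<open>J\<close> over the factors, only the distribution by the members of \<open>I\<close>
  contributes to the product.
\<close>

lemma zeta_tuple_eq:
  fixes I :: "'n::finite \<Rightarrow> 'i::countable list"
  shows "zeta_tuple I J = (if I \<in> tuples J then tuple_value var I else 0)"
proof -
  let ?A = "\<lambda>\<nu>. set (I \<nu>)"
  let ?F = "{A :: 'n \<Rightarrow> 'i set. disjoint_family A \<and> (\<Union>\<nu>. A \<nu>) = J}"
  let ?g = "\<lambda>A. \<Prod>\<nu>\<in>UNIV. zeta_seq \<nu> (I \<nu>) (A \<nu>) :: ('i, 'n) ratfun"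
  have z: "?g A = 0" if "A \<noteq> ?A" for A
    using that by (auto simp: zeta_seq_def fun_eq_iff)
  have g: "?g ?A = (if \<forall>\<nu>. distinct (I \<nu>) then tuple_value var I else 0)"
    by (auto simp: zeta_seq_def tuple_value_def chain_value_def zeta_denom_eq)
  show ?thesis
  proof (cases "finite J")
    case True
    then have "finite (Pow J)" by simp
    then have "finite (PiE UNIV (\<lambda>_::'n. Pow J))"
      by (intro finite_PiE) auto
    then have fin: "finite ?F"
      by (rule rev_finite_subset) (auto simp: PiE_UNIV_domain)
    have "zeta_tuple I J = (\<Sum>A\<in>?F \<inter> {?A}. ?g A)"
      unfolding zeta_tuple_def polydiff_prod_def
    proof (intro sum.mono_neutral_right fin ballI)
      show "?g A = 0" if "A \<in> ?F - ?F \<inter> {?A}" for A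
        using that by (intro z) blast
    qed auto
    also have "?F \<inter> {?A} = (if ?A \<in> ?F then {?A} else {})"
      by auto
    finally show ?thesis
      using g by (auto simp: tuples_def)
  next
    case False
    then have "?A \<notin> ?F" by auto
    then have "zeta_tuple I J = 0"
      unfolding zeta_tuple_def polydiff_prod_def
    proof (intro sum.neutral ballI)
      show "?g A = 0" if "A \<in> ?F" for A
        using that \<open>?A \<notin> ?F\<close> by (intro z) blast
    qed
    with False show ?thesis by (simp add: tuples_infinite)
  qed
qed

lemma prod_over_tuple:
  assumes "I \<in> tuples J"
  shows "(\<Prod>i\<in>J. h i) = (\<Prod>\<nu>\<in>UNIV. prod_list (map h (I (\<nu>::'n::finite))))"
proof -
  have "(\<Prod>i\<in>(\<Union>\<nu>. set (I \<nu>)). h i) = (\<Prod>\<nu>\<in>UNIV. prod h (set (I \<nu>)))"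
    using assms by (intro prod.UNION_disjoint) (auto simp: tuples_def disjoint_family_on_def)
  also have "\<dots> = (\<Prod>\<nu>\<in>UNIV. prod_list (map h (I \<nu>)))"
    using assms by (intro prod.cong refl prod.distinct_set_conv_list) (auto simp: tuples_def)
  finally show ?thesis
    using assms by (simp add: tuples_def)
qed

lemma tuples_insert_head:
  assumes "i \<in> J"
  shows "I(\<nu> := i # I \<nu>) \<in> tuples J \<longleftrightarrow> I \<in> tuples (J - {i})"
proof
  assume *: "I(\<nu> := i # I \<nu>) \<in> tuples J"
  have d: "distinct ((I(\<nu> := i # I \<nu>)) \<mu>)" for \<mu>
    using * by (simp add: tuples_def)
  have e: "\<mu> \<noteq> \<kappa> \<Longrightarrow> set ((I(\<nu> := i # I \<nu>)) \<mu>) \<inter> set ((I(\<nu> := i # I \<nu>)) \<kappa>) = {}" for \<mu> \<kappa>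
    using * by (simp add: tuples_def disjoint_family_on_def)
  have u: "(\<Union>\<mu>. set ((I(\<nu> := i # I \<nu>)) \<mu>)) = J"
    using * by (simp add: tuples_def)
  have 1: "distinct (I \<mu>)" "i \<notin> set (I \<mu>)" for \<mu>
    using d[of \<mu>] d[of \<nu>] e[of \<nu> \<mu>] by (cases "\<mu> = \<nu>"; auto)+
  have 2: "\<mu> \<noteq> \<kappa> \<Longrightarrow> set (I \<mu>) \<inter> set (I \<kappa>) = {}" for \<mu> \<kappa>
    using e[of \<mu> \<kappa>] by (auto split: if_splits)
  have "(\<Union>\<mu>. set ((I(\<nu> := i # I \<nu>)) \<mu>)) = insert i (\<Union>\<mu>. set (I \<mu>))"
    by (auto split: if_splits)
  with u 1(2) have "(\<Union>\<mu>. set (I \<mu>)) = J - {i}"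
    by auto
  with 1 2 show "I \<in> tuples (J - {i})"
    by (auto simp: tuples_def disjoint_family_on_def)
next
  assume *: "I \<in> tuples (J - {i})"
  have "(\<Union>\<mu>. set ((I(\<nu> := i # I \<nu>)) \<mu>)) = insert i (\<Union>\<mu>. set (I \<mu>))"
    by (auto split: if_splits)
  also have "\<dots> = J"
    using * assms by (auto simp: tuples_def)
  finally have u: "(\<Union>\<mu>. set ((I(\<nu> := i # I \<nu>)) \<mu>)) = J" .
  have "i \<notin> set (I \<mu>)" for \<mu>
    using * by (auto simp: tuples_def)
  with * u show "I(\<nu> := i # I \<nu>) \<in> tuples J"
    by (auto simp: tuples_def disjoint_family_on_def)
qed

text \<open>
  Reversal exchanges the two ends of the sequences, so that facts about first entries carry over
  to last entries.
\<close>

lemma tuples_rev: "(\<lambda>\<nu>. rev (I \<nu>)) \<in> tuples J \<longleftrightarrow> I \<in> tuples J"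
  by (simp add: tuples_def)

lemma tuples_insert_last:
  assumes "i \<in> J"
  shows "I(\<nu> := I \<nu> @ [i]) \<in> tuples J \<longleftrightarrow> I \<in> tuples (J - {i})"
proof -
  have "(\<lambda>\<mu>. rev ((I(\<nu> := I \<nu> @ [i])) \<mu>)) = (\<lambda>\<mu>. rev (I \<mu>))(\<nu> := i # rev (I \<nu>))"
    by auto
  then show ?thesis
    using tuples_insert_head[OF assms, of "\<lambda>\<mu>. rev (I \<mu>)" \<nu>] tuples_rev[of I]
      tuples_rev[of "I(\<nu> := I \<nu> @ [i])"] by simp
qed

lemma inj_imp_chain_denom_neq_0:
  assumes "inj \<theta>" "distinct I"
  shows "chain_denom (\<theta> (Z \<nu>)) (map (\<lambda>i. \<theta> (T i)) I) \<noteq> 0"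
proof -
  have "distinct (map \<theta> (map T I @ [Z \<nu>]))"
    unfolding distinct_map using assms by (auto simp: inj_on_def distinct_map)
  then show ?thesis
    unfolding chain_denom_neq_0_iff by (auto intro!: distinct_imp_distinct_adj simp: o_def)
qed

lemma evaluates_chain_denom:
  "evaluates \<theta> (chain_denom (var (v)) (map (\<lambda>i. var (T i)) I))
     (chain_denom (\<theta> (v)) (map (\<lambda>i. \<theta> (T i)) I))"
proof (induction I)
  case Nil
  then show ?case by (simp add: evaluates_1)
next
  case (Cons i I)
  have "evaluates \<theta> (hd (map (\<lambda>i. var (T i)) I @ [var (v)]))
      (hd (map (\<lambda>i. \<theta> (T i)) I @ [\<theta> (v)]))"
    by (cases I) (auto intro: evaluates_var)
  then show ?case
    using Cons by (auto intro!: evaluates_mult evaluates_diff evaluates_var)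
qed

lemma evaluates_chain_value:
  assumes "distinct_adj (map (\<lambda>i. \<theta> (T i)) I @ [\<theta> (Z \<nu>)])"
  shows "evaluates \<theta> (chain_value var \<nu> I) (chain_value \<theta> \<nu> I)"
  unfolding chain_value_def
  by (intro evaluates_inverse evaluates_chain_denom) (use assms in \<open>simp add: chain_denom_neq_0_iff\<close>)

lemma evaluates_tuple_value:
  assumes "inj \<theta>" "I \<in> tuples J"
  shows "evaluates \<theta> (tuple_value var I) (tuple_value \<theta> I)"
  unfolding tuple_value_def chain_value_def using assms
  by (intro evaluates_prod evaluates_inverse evaluates_chain_denom inj_imp_chain_denom_neq_0)
    (auto simp: tuples_def)

section \<open>Residues and linear independence\<close>

text \<open>
  The residue along \<open>t\<^sub>i = z\<^sub>\<nu>\<close>, computed by substitution: after multiplication by \<open>t\<^sub>i - z\<^sub>\<nu>\<close> one may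
  set \<open>t\<^sub>i = z\<^sub>\<nu>\<close>. The only denominators with a factor \<open>t\<^sub>i - z\<^sub>\<nu>\<close> are those of the tuples in which
  \<open>i\<close> is the last entry at \<open>\<nu>\<close>. There the factor cancels, and the next entry becomes linked
  to \<open>z\<^sub>\<nu>\<close>; everywhere else the result is zero.
\<close>

lemma evaluates_residue:
  fixes I :: "'n::finite \<Rightarrow> 'i::countable list" and i :: 'i and \<nu> :: 'n
  assumes I: "I \<in> tuples J"
  defines "\<theta> \<equiv> var(T i := var (Z \<nu>))"
  shows "evaluates \<theta> ((var (T i) - var (Z \<nu>)) * tuple_value var I)
    (if I \<nu> \<noteq> [] \<and> last (I \<nu>) = i then tuple_value var (I(\<nu> := butlast (I \<nu>))) else 0)"
proof -
  have dist: "distinct (I \<mu>)" for \<mu>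
    using I by (simp add: tuples_def)
  have \<theta>_Ti: "\<theta> (T i) = var (Z \<nu>)"
    by (simp add: \<theta>_def)
  have \<theta>_Z: "\<theta> (Z \<mu>) = var (Z \<mu>)" for \<mu>
    by (simp add: \<theta>_def)
  have \<theta>_T: "map (\<lambda>j. \<theta> (T j)) L = map (\<lambda>j. var (T j)) L" if "i \<notin> set L" for L
    using that by (auto simp: \<theta>_def)
  have inj_T: "inj (\<lambda>j. var (T j :: ('i, 'n) pvar))"
    by (auto simp: inj_def var_eq_iff)
  have untouched: "evaluates \<theta> (chain_value var \<mu> L) (chain_value var \<mu> L)"
    if "i \<notin> set L" "distinct L" for \<mu> L
  proof -
    have "distinct (map (\<lambda>j. \<theta> (T j)) L @ [\<theta> (Z \<mu>)])"
      using that inj_T by (auto simp: \<theta>_T \<theta>_Z distinct_map var_eq_iff intro: inj_on_subset)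
    from distinct_imp_distinct_adj[OF this]
    have "evaluates \<theta> (chain_value var \<mu> L) (chain_value \<theta> \<mu> L)"
      by (rule evaluates_chain_value)
    then show ?thesis
      by (simp add: chain_value_def \<theta>_T[OF that(1)] \<theta>_Z)
  qed
  show ?thesis
  proof (cases "I \<nu> \<noteq> [] \<and> last (I \<nu>) = i")
    case True
    then obtain U where U: "I \<nu> = U @ [i]"
      by (metis append_butlast_last_id)
    have "i \<notin> set U" "distinct U"
      using dist[of \<nu>] U by auto
    have "i \<notin> set (I \<mu>)" if "\<mu> \<noteq> \<nu>" for \<mu>
      using I that U by (fastforce simp: tuples_def disjoint_family_on_def)
    then have rest: "evaluates \<theta> (\<Prod>\<mu>\<in>UNIV - {\<nu>}. chain_value var \<mu> (I \<mu>))
        (\<Prod>\<mu>\<in>UNIV - {\<nu>}. chain_value var \<mu> (I \<mu>))"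
      by (intro evaluates_prod untouched dist) auto
    let ?c = "chain_denom (var (T i)) (map (\<lambda>j. var (T j)) U) :: ('i, 'n) ratfun"
    \<comment> \<open>The factor \<open>t\<^sub>i - z\<^sub>\<nu>\<close> is the last one in the denominator of the chain at \<open>\<nu>\<close>.\<close>
    have cancel: "(var (T i) - var (Z \<nu>)) * chain_value var \<nu> (I \<nu>) = 1 / ?c"
      by (simp add: chain_value_def U chain_denom_snoc var_eq_iff)
    have "evaluates \<theta> (1 / ?c) (chain_value var \<nu> U)"
    proof -
      have "distinct (map (\<lambda>j. var (T j)) U @ [var (Z \<nu>) :: ('i, 'n) ratfun])"
        using \<open>distinct U\<close> inj_T by (auto simp: distinct_map var_eq_iff intro: inj_on_subset)
      from distinct_imp_distinct_adj[OF this]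
      have "chain_denom (var (Z \<nu>)) (map (\<lambda>j. var (T j)) U) \<noteq> (0 :: ('i, 'n) ratfun)"
        by (simp add: chain_denom_neq_0_iff)
      moreover have "evaluates \<theta> ?c (chain_denom (var (Z \<nu>)) (map (\<lambda>j. var (T j)) U))"
        using evaluates_chain_denom[of \<theta> "T i" U] unfolding \<theta>_T[OF \<open>i \<notin> set U\<close>] \<theta>_Ti .
      ultimately show ?thesis
        unfolding chain_value_def by (intro evaluates_inverse)
    qed
    then have "evaluates \<theta> (1 / ?c * (\<Prod>\<mu>\<in>UNIV - {\<nu>}. chain_value var \<mu> (I \<mu>)))
       (chain_value var \<nu> U * (\<Prod>\<mu>\<in>UNIV - {\<nu>}. chain_value var \<mu> (I \<mu>)))"
      by (intro evaluates_mult rest)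
    moreover have "1 / ?c * (\<Prod>\<mu>\<in>UNIV - {\<nu>}. chain_value var \<mu> (I \<mu>))
        = (var (T i) - var (Z \<nu>)) * tuple_value var I"
      unfolding tuple_value_def cancel[symmetric]
      by (simp add: prod.remove[of UNIV \<nu>])
    moreover have "chain_value var \<nu> U * (\<Prod>\<mu>\<in>UNIV - {\<nu>}. chain_value var \<mu> (I \<mu>))
        = tuple_value var (I(\<nu> := butlast (I \<nu>)))"
      unfolding tuple_value_def by (simp add: prod.remove[of UNIV \<nu>] U)
    ultimately show ?thesis
      using True by simp
  next
    case False
    have "distinct_adj (map (\<lambda>j. \<theta> (T j)) (I \<mu>) @ [\<theta> (Z \<mu>)])" for \<mu>
    proof (cases "i \<in> set (I \<mu>)")
      case True
      then obtain U V where UV: "I \<mu> = U @ i # V"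
        by (meson split_list)
      have UV': "i \<notin> set U" "i \<notin> set V" "distinct (U @ V)" "\<mu> = \<nu> \<Longrightarrow> V \<noteq> []"
        using dist[of \<mu>] UV False by auto
      have V: "distinct (map (\<lambda>j. \<theta> (T j)) V @ [\<theta> (Z \<mu>)])"
        using UV' inj_T by (auto simp: \<theta>_T \<theta>_Z distinct_map var_eq_iff intro: inj_on_subset)
      have U: "distinct (map (\<lambda>j. \<theta> (T j)) U @ [\<theta> (T i)])"
        using UV' inj_T by (auto simp: \<theta>_T \<theta>_Ti distinct_map var_eq_iff intro: inj_on_subset)
      \<comment> \<open>This is where \<open>V\<close> must be nonempty if \<open>\<mu> = \<nu>\<close>: the chain is cut at \<open>i\<close>, whose value is that of \<open>Z \<nu>\<close>.\<close>
      have "\<theta> (T i) \<noteq> hd (map (\<lambda>j. \<theta> (T j)) V @ [\<theta> (Z \<mu>)])"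
        using UV' by (cases V) (auto simp: \<theta>_def var_eq_iff)
      with U[THEN distinct_imp_distinct_adj] V[THEN distinct_imp_distinct_adj]
      show ?thesis
        unfolding UV by (auto simp: distinct_adj_append_iff distinct_adj_Cons)
    next
      case False
      then have "distinct (map (\<lambda>j. \<theta> (T j)) (I \<mu>) @ [\<theta> (Z \<mu>)])"
        using inj_T dist by (auto simp: \<theta>_T \<theta>_Z distinct_map var_eq_iff intro: inj_on_subset)
      then show ?thesis
        by (rule distinct_imp_distinct_adj)
    qed
    then have "evaluates \<theta> (tuple_value var I) (tuple_value \<theta> I)"
      unfolding tuple_value_def by (intro evaluates_prod evaluates_chain_value)
    then have "evaluates \<theta> ((var (T i) - var (Z \<nu>)) * tuple_value var I)
        ((\<theta> (T i) - \<theta> (Z \<nu>)) * tuple_value \<theta> I)"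
      by (intro evaluates_mult evaluates_diff evaluates_var)
    then show ?thesis
      unfolding if_not_P[OF False] by (simp add: \<theta>_Ti \<theta>_Z)
  qed
qed

text \<open>
  A nonempty tuple is determined by \<open>\<nu>\<close>, the last entry \<open>i\<close> at \<open>\<nu>\<close>, and the rest. The residue
  along \<open>t\<^sub>i = z\<^sub>\<nu>\<close> turns a linear relation on \<open>J\<close> into one on \<open>J - {i}\<close> that has the same
  coefficient at the rest.
\<close>

lemma tuple_values_independent:
  fixes c :: "('n::finite \<Rightarrow> 'i::countable list) \<Rightarrow> complex"
  assumes "finite J"
    and "(\<Sum>I\<in>tuples J. const (c I) * (tuple_value var I :: ('i, 'n) ratfun)) = 0"
    and "I \<in> tuples J"
  shows "c I = 0"
  using assms
proof (induction "card J" arbitrary: J c I)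
  case 0
  then have "J = {}" by simp
  then have "tuples J = {\<lambda>_::'n. [] :: 'i list}"
    by (auto simp: tuples_def disjoint_family_on_def)
  with 0 show ?case
    by (simp add: tuple_value_def chain_value_def const_eq_0_iff)
next
  case (Suc m)
  have "J \<noteq> {}" using Suc by auto
  then obtain \<nu> where "I \<nu> \<noteq> []"
    using Suc.prems(3) by (fastforce simp: tuples_def)
  define i where "i = last (I \<nu>)"
  define K where "K = I(\<nu> := butlast (I \<nu>))"
  have "i \<in> set (I \<nu>)"
    using \<open>I \<nu> \<noteq> []\<close> by (simp add: i_def)
  then have "i \<in> J"
    using Suc.prems(3) by (auto simp: tuples_def)
  have IK: "I = K(\<nu> := K \<nu> @ [i])"
    using \<open>I \<nu> \<noteq> []\<close> by (simp add: K_def i_def)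
  then have K: "K \<in> tuples (J - {i})"
    using tuples_insert_last[OF \<open>i \<in> J\<close>] Suc.prems(3) by metis
  let ?r = "\<lambda>L. if L \<nu> \<noteq> [] \<and> last (L \<nu>) = i
    then tuple_value var (L(\<nu> := butlast (L \<nu>))) else 0 :: ('i, 'n) ratfun"
  have "evaluates (var(T i := var (Z \<nu>)))
      (\<Sum>L\<in>tuples J. const (c L) * ((var (T i) - var (Z \<nu>)) * tuple_value var L))
      (\<Sum>L\<in>tuples J. const (c L) * ?r L)"
    by (intro evaluates_sum evaluates_mult evaluates_const evaluates_residue)
  also have "(\<Sum>L\<in>tuples J. const (c L) * ((var (T i) - var (Z \<nu>)) * tuple_value var L))
      = (var (T i) - var (Z \<nu>)) * (\<Sum>L\<in>tuples J. const (c L) * tuple_value var L)"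
    by (simp add: sum_distrib_left mult_ac)
  also have "\<dots> = 0"
    by (simp add: Suc.prems)
  finally have "(\<Sum>L\<in>tuples J. const (c L) * ?r L) = 0"
    using evaluates_0 evaluates_unique by blast
  also have "(\<Sum>L\<in>tuples J. const (c L) * ?r L)
      = (\<Sum>L\<in>{L \<in> tuples J. L \<nu> \<noteq> [] \<and> last (L \<nu>) = i}. const (c L) * ?r L)"
    by (rule sum.mono_neutral_right) (auto simp: finite_tuples Suc.prems)
  also have "\<dots> = (\<Sum>L\<in>tuples (J - {i}). const (c (L(\<nu> := L \<nu> @ [i]))) * tuple_value var L)"
  proof (rule sum.reindex_bij_witness[where i = "\<lambda>L. L(\<nu> := L \<nu> @ [i])"
        and j = "\<lambda>L. L(\<nu> := butlast (L \<nu>))"])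
    fix L assume L: "L \<in> {L \<in> tuples J. L \<nu> \<noteq> [] \<and> last (L \<nu>) = i}"
    let ?L = "L(\<nu> := butlast (L \<nu>))"
    show *: "?L(\<nu> := ?L \<nu> @ [i]) = L"
      using L by (auto simp: fun_eq_iff)
    show "?L \<in> tuples (J - {i})"
      using tuples_insert_last[OF \<open>i \<in> J\<close>, of ?L \<nu>] L * by simp
    show "const (c (?L(\<nu> := ?L \<nu> @ [i]))) * tuple_value var ?L = const (c L) * ?r L"
      using L unfolding * by simp
  qed (auto simp: tuples_insert_last[OF \<open>i \<in> J\<close>])
  finally have "(\<Sum>L\<in>tuples (J - {i}). const (c (L(\<nu> := L \<nu> @ [i]))) *
      (tuple_value var L :: ('i, 'n) ratfun)) = 0" .
  moreover have "m = card (J - {i})"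
    using \<open>i \<in> J\<close> Suc by simp
  ultimately have "c (K(\<nu> := K \<nu> @ [i])) = 0"
    using Suc.hyps(1)[of "J - {i}" "\<lambda>L. c (L(\<nu> := L \<nu> @ [i]))" K] K Suc.prems(1) by blast
  then show ?case
    using IK by simp
qed

section \<open>Invariance of primitive sums under Moebius transformations\<close>

definition mobius :: "'a::field \<Rightarrow> 'a \<Rightarrow> 'a \<Rightarrow> 'a \<Rightarrow> 'a \<Rightarrow> 'a"
  where "mobius a b c d x = (a * x + b) / (c * x + d)"

lemma mobius_diff:
  assumes "c * x + d \<noteq> 0" "c * y + d \<noteq> 0"
  shows "mobius a b c d x - mobius a b c d y
    = (a * d - b * c) * (x - y) / ((c * x + d) * (c * y + d))"
  using assms unfolding mobius_def by (simp add: diff_frac_eq) (simp add: algebra_simps)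

text \<open>
  Every entry \<open>x\<close> brings \<open>(c x + d)\<^sup>2\<close> into the denominator with its derivative, and the difference
  of two transformed points cancels one copy for each of them. As the first entry occurs in one
  difference only, a copy of its factor stays in the denominator; the base point brings no derivative,
  so that its factor stays in the numerator.
\<close>

lemma chain_mobius:
  fixes z :: "'a::field"
  assumes "a * d - b * c \<noteq> 0" "\<And>x. x \<in> insert z (set xs) \<Longrightarrow> c * x + d \<noteq> 0"
  shows "prod_list (map (\<lambda>x. (a * d - b * c) / (c * x + d) ^ 2) xs)
      / chain_denom (mobius a b c d z) (map (mobius a b c d) xs)
    = (c * z + d) / (c * hd (xs @ [z]) + d) * (1 / chain_denom z xs)"
  using assms(2)
proof (induction xs)
  case Nil
  then show ?case by simp
next
  case (Cons x xs)
  let ?h = "hd (xs @ [z])" and ?D = "a * d - b * c"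
  have h: "hd (map (mobius a b c d) xs @ [mobius a b c d z]) = mobius a b c d ?h"
    by (cases xs) auto
  have "?h \<in> insert z (set xs)"
    by (cases xs) auto
  then have nz: "c * x + d \<noteq> 0" "c * ?h + d \<noteq> 0"
    using Cons.prems by auto
  have "?D / (c * x + d) ^ 2 / (mobius a b c d x - mobius a b c d ?h)
      = (c * ?h + d) / (c * x + d) * (1 / (x - ?h))"
    using assms(1) nz by (simp add: mobius_diff power2_eq_square)
  moreover have "prod_list (map (\<lambda>x. ?D / (c * x + d) ^ 2) xs)
      / chain_denom (mobius a b c d z) (map (mobius a b c d) xs)
    = (c * z + d) / (c * ?h + d) * (1 / chain_denom z xs)"
    by (rule Cons.IH) (use Cons.prems in auto)
  ultimately have "?D / (c * x + d) ^ 2 * prod_list (map (\<lambda>x. ?D / (c * x + d) ^ 2) xs)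
      / ((mobius a b c d x - mobius a b c d ?h) *
        chain_denom (mobius a b c d z) (map (mobius a b c d) xs))
    = ((c * ?h + d) / (c * x + d) * (1 / (x - ?h)))
      * ((c * z + d) / (c * ?h + d) * (1 / chain_denom z xs))"
    by (simp only: times_divide_times_eq[symmetric])
  also have "\<dots> = (c * z + d) / (c * x + d) * (1 / ((x - ?h) * chain_denom z xs))"
    using nz by simp
  finally show ?case
    by (simp only: list.map prod_list.Cons chain_denom.simps h append.simps list.sel)
qed

lemma split_fraction:
  fixes p q s :: "'a::field"
  assumes "p \<noteq> 0" "q \<noteq> 0" "s \<noteq> 0"
  shows "u * v * (x * p - y * q) / (p * q * s) = u * y / p * (v / - s) + u * v / q * (x / s)"
proof -
  have "u * v * (x * p - y * q) / (p * q * s)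
      = u * v * x * p / (p * q * s) - u * v * y * q / (p * q * s)"
    by (simp only: diff_divide_distrib right_diff_distrib mult.assoc)
  also have "u * v * x * p / (p * q * s) = u * v / q * (x / s)"
    using assms by simp
  also have "u * v * y * q / (p * q * s) = - (u * y / p * (v / - s))"
    using assms by simp
  finally show ?thesis
    by simp
qed

text \<open>
  The partial fraction expansion in the variable \<open>- d / c\<close>, stated homogeneously so that it includes
  the affine case \<open>c = 0\<close>. The induction needs arbitrary \<open>c\<close> and \<open>d\<close>: the product
  in the term of the new index \<open>\<kappa>\<close> is the left-hand side for the old ones at \<open>c = 1\<close>,
  \<open>d = - t \<kappa>\<close>.
\<close>

lemma prod_mobius_partial_fractions:
  fixes z t :: "'b \<Rightarrow> 'a::field"
  assumes "finite N" "inj_on t N" "\<And>\<nu>. \<nu> \<in> N \<Longrightarrow> c * t \<nu> + d \<noteq> 0"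
  shows "(\<Prod>\<nu>\<in>N. (c * z \<nu> + d) / (c * t \<nu> + d))
    = 1 + (\<Sum>\<nu>\<in>N. c * (z \<nu> - t \<nu>) / (c * t \<nu> + d) *
        (\<Prod>\<mu>\<in>N - {\<nu>}. (z \<mu> - t \<nu>) / (t \<mu> - t \<nu>)))"
  using assms
proof (induction N arbitrary: c d rule: finite_induct)
  case empty
  then show ?case by simp
next
  case (insert \<kappa> N)
  let ?R = "\<lambda>\<nu>. \<Prod>\<mu>\<in>N - {\<nu>}. (z \<mu> - t \<nu>) / (t \<mu> - t \<nu>)"
  have t: "t \<nu> \<noteq> t \<kappa>" if "\<nu> \<in> N" for \<nu>
    using that insert by (auto simp: inj_on_def)
  have nz: "c * t \<nu> + d \<noteq> 0" if "\<nu> \<in> insert \<kappa> N" for \<nu>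
    using that insert.prems by blast
  have IH: "(\<Prod>\<nu>\<in>N. (c * z \<nu> + d) / (c * t \<nu> + d))
      = 1 + (\<Sum>\<nu>\<in>N. c * (z \<nu> - t \<nu>) / (c * t \<nu> + d) * ?R \<nu>)"
    using insert by (intro insert.IH) auto
  have IH': "(\<Prod>\<nu>\<in>N. (z \<nu> - t \<kappa>) / (t \<nu> - t \<kappa>))
      = 1 + (\<Sum>\<nu>\<in>N. (z \<nu> - t \<nu>) / (t \<nu> - t \<kappa>) * ?R \<nu>)"
    using insert.IH[of 1 "- t \<kappa>"] insert.prems(1) t by simp
  \<comment> \<open>The simple poles at \<open>c * t \<kappa> + d = 0\<close> and \<open>c * t \<nu> + d = 0\<close> are separated.\<close>
  have step: "(c * z \<kappa> + d) / (c * t \<kappa> + d) * (c * (z \<nu> - t \<nu>) / (c * t \<nu> + d))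
      = c * (z \<kappa> - t \<kappa>) / (c * t \<kappa> + d) * ((z \<nu> - t \<nu>) / (t \<nu> - t \<kappa>))
        + c * (z \<nu> - t \<nu>) / (c * t \<nu> + d) * ((z \<kappa> - t \<nu>) / (t \<kappa> - t \<nu>))"
    (is "?l = ?r") if "\<nu> \<in> N" for \<nu>
  proof -
    define p q s where "p = c * t \<kappa> + d" and "q = c * t \<nu> + d" and "s = t \<kappa> - t \<nu>"
    have nz': "p \<noteq> 0" "q \<noteq> 0" "s \<noteq> 0" "t \<nu> - t \<kappa> = - s"
      using nz[of \<kappa>] nz[of \<nu>] t[OF that] that by (auto simp: p_def q_def s_def)
    have poly: "(c * z \<kappa> + d) * s = (z \<kappa> - t \<nu>) * p - (z \<kappa> - t \<kappa>) * q"
      by (simp add: p_def q_def s_def algebra_simps)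
    have "?l = c * (z \<nu> - t \<nu>) * ((c * z \<kappa> + d) * s) / (p * q * s)"
      using nz' by (simp add: p_def[symmetric] q_def[symmetric])
    also have "\<dots> = ?r"
      unfolding poly p_def[symmetric] q_def[symmetric] nz'(4) s_def[symmetric]
      by (rule split_fraction[OF nz'(1-3)])
    finally show ?thesis .
  qed
  have R: "(\<Prod>\<mu>\<in>insert \<kappa> N - {\<nu>}. (z \<mu> - t \<nu>) / (t \<mu> - t \<nu>))
      = (z \<kappa> - t \<nu>) / (t \<kappa> - t \<nu>) * ?R \<nu>" if "\<nu> \<in> N" for \<nu>
  proof -
    have "insert \<kappa> N - {\<nu>} = insert \<kappa> (N - {\<nu>})"
      using that insert.hyps by auto
    then show ?thesis
      using insert.hyps by simp
  qed
  have R\<kappa>: "insert \<kappa> N - {\<kappa>} = N"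
    using insert.hyps by auto
  let ?u = "c * (z \<kappa> - t \<kappa>) / (c * t \<kappa> + d)"
  let ?V = "\<Sum>\<nu>\<in>N. (z \<nu> - t \<nu>) / (t \<nu> - t \<kappa>) * ?R \<nu>"
  let ?W = "\<Sum>\<nu>\<in>N. c * (z \<nu> - t \<nu>) / (c * t \<nu> + d) *
    ((z \<kappa> - t \<nu>) / (t \<kappa> - t \<nu>) * ?R \<nu>)"
  have expand: "(\<Prod>\<nu>\<in>insert \<kappa> N. (c * z \<nu> + d) / (c * t \<nu> + d))
      = (c * z \<kappa> + d) / (c * t \<kappa> + d)
        + (\<Sum>\<nu>\<in>N. (c * z \<kappa> + d) / (c * t \<kappa> + d) * (c * (z \<nu> - t \<nu>) / (c * t \<nu> + d)) * ?R \<nu>)"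
    using insert.hyps by (simp add: IH distrib_left sum_distrib_left mult.assoc)
  have lead: "(c * z \<kappa> + d) / (c * t \<kappa> + d) = 1 + ?u"
    using nz[of \<kappa>] by (simp add: add_divide_eq_if_simps right_diff_distrib)
  have split: "(\<Sum>\<nu>\<in>N. (c * z \<kappa> + d) / (c * t \<kappa> + d) * (c * (z \<nu> - t \<nu>) / (c * t \<nu> + d)) * ?R \<nu>)
      = ?u * ?V + ?W"
    unfolding sum_distrib_left sum.distrib[symmetric]
    by (intro sum.cong refl) (simp only: step distrib_right mult.assoc)
  have "(\<Prod>\<nu>\<in>insert \<kappa> N. (c * z \<nu> + d) / (c * t \<nu> + d)) = 1 + ?u + (?u * ?V + ?W)"
    by (rule trans[OF expand arg_cong2[where f = "(+)", OF lead split]])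
  then have "(\<Prod>\<nu>\<in>insert \<kappa> N. (c * z \<nu> + d) / (c * t \<nu> + d)) = 1 + (?u * (1 + ?V) + ?W)"
    by (simp only: distrib_left mult_1_right add.assoc)
  moreover have "(\<Sum>\<nu>\<in>insert \<kappa> N. c * (z \<nu> - t \<nu>) / (c * t \<nu> + d) *
      (\<Prod>\<mu>\<in>insert \<kappa> N - {\<nu>}. (z \<mu> - t \<nu>) / (t \<mu> - t \<nu>))) = ?u * (1 + ?V) + ?W"
    unfolding IH'[symmetric] sum.insert[OF insert.hyps] R\<kappa>
    by (simp only: R cong: sum.cong)
  ultimately show ?case
    by (simp only:)
qed

definition top_value :: "(('i, 'n) pvar \<Rightarrow> 'a) \<Rightarrow> 'n \<Rightarrow> 'i list \<Rightarrow> 'a"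
  where "top_value \<theta> \<nu> I = hd (map (\<lambda>i. \<theta> (T i)) I @ [\<theta> (Z \<nu>)])"

lemma tuple_value_mobius:
  fixes \<theta> :: "('i, 'n::finite) pvar \<Rightarrow> 'a::field"
  assumes D: "a * d - b * c \<noteq> 0" and nz: "\<And>v. c * \<theta> v + d \<noteq> 0" and I: "I \<in> tuples J"
  shows "tuple_value (\<lambda>v. mobius a b c d (\<theta> v)) I *
      (\<Prod>i\<in>J. (a * d - b * c) / (c * \<theta> (T i) + d) ^ 2)
    = (\<Prod>\<nu>\<in>UNIV. (c * \<theta> (Z \<nu>) + d) / (c * top_value \<theta> \<nu> (I \<nu>) + d)) * tuple_value \<theta> I"
proof -
  have "chain_value (\<lambda>v. mobius a b c d (\<theta> v)) \<nu> L *
        prod_list (map (\<lambda>i. (a * d - b * c) / (c * \<theta> (T i) + d) ^ 2) L)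
      = (c * \<theta> (Z \<nu>) + d) / (c * top_value \<theta> \<nu> L + d) * chain_value \<theta> \<nu> L" for \<nu> L
    using chain_mobius[OF D, of "\<theta> (Z \<nu>)" "map (\<lambda>i. \<theta> (T i)) L"] nz
    by (auto simp: chain_value_def top_value_def o_def)
  then show ?thesis
    unfolding tuple_value_def prod_over_tuple[OF I]
    by (simp only: prod.distrib[symmetric])
qed

lemma tuple_value_add_head:
  "tuple_value \<theta> (I(\<nu> := i # I \<nu>))
    = tuple_value \<theta> I / (\<theta> (T i) - top_value \<theta> \<nu> (I \<nu>))"
proof -
  have "chain_value \<theta> \<nu> (i # I \<nu>) = chain_value \<theta> \<nu> (I \<nu>) / (\<theta> (T i) - top_value \<theta> \<nu> (I \<nu>))"
    by (simp add: chain_value_def top_value_def)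
  then show ?thesis
    unfolding tuple_value_def by (simp add: prod.remove[of UNIV \<nu>])
qed

text \<open>
  To mark a nonempty member of a tuple is to give its first entry, its place, and the tuple that
  remains when this entry is deleted.
\<close>

lemma sum_tuples_by_head:
  fixes F :: "('n::finite \<Rightarrow> 'i list) \<Rightarrow> 'n \<Rightarrow> 'a::comm_monoid_add"
  assumes "finite J" "\<And>I \<nu>. I \<nu> = [] \<Longrightarrow> F I \<nu> = 0"
  shows "(\<Sum>I\<in>tuples J. \<Sum>\<nu>\<in>UNIV. F I \<nu>)
    = (\<Sum>i\<in>J. \<Sum>I\<in>tuples (J - {i}). \<Sum>\<nu>\<in>UNIV. F (I(\<nu> := i # I \<nu>)) \<nu>)"
proof -
  let ?A = "{(I :: 'n \<Rightarrow> 'i list, \<nu>). I \<in> tuples J \<and> I \<nu> \<noteq> []}"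
  let ?add = "\<lambda>(i, I :: 'n \<Rightarrow> 'i list, \<nu>). (I(\<nu> := i # I \<nu>), \<nu>)"
  let ?remove = "\<lambda>(I :: 'n \<Rightarrow> 'i list, \<nu>). (hd (I \<nu>), I(\<nu> := tl (I \<nu>)), \<nu>)"
  let ?B = "Sigma J (\<lambda>i. tuples (J - {i}) \<times> (UNIV :: 'n set))"
  have "(\<Sum>I\<in>tuples J. \<Sum>\<nu>\<in>UNIV. F I \<nu>) = (\<Sum>(I, \<nu>)\<in>tuples J \<times> UNIV. F I \<nu>)"
    by (simp add: sum.cartesian_product)
  also have "\<dots> = (\<Sum>(I, \<nu>)\<in>?A. F I \<nu>)"
    by (rule sum.mono_neutral_right) (auto simp: finite_tuples assms)
  also have "\<dots> = (\<Sum>(i, I, \<nu>)\<in>?B. F (I(\<nu> := i # I \<nu>)) \<nu>)"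
  proof (rule sum.reindex_bij_witness[where i = ?add and j = ?remove])
    fix x assume "x \<in> ?A"
    then obtain I \<nu> where x: "x = (I, \<nu>)" "I \<in> tuples J" "I \<nu> \<noteq> []" by auto
    define i K where "i = hd (I \<nu>)" and "K = I(\<nu> := tl (I \<nu>))"
    have remove: "?remove x = (i, K, \<nu>)"
      by (simp add: x(1) i_def K_def)
    have add: "K(\<nu> := i # K \<nu>) = I"
      using x(3) by (auto simp: fun_eq_iff i_def K_def)
    have "i \<in> set (I \<nu>)"
      unfolding i_def by (rule hd_in_set[OF x(3)])
    moreover have "(\<Union>\<nu>. set (I \<nu>)) = J"
      using x(2) by (simp add: tuples_def)
    ultimately have "i \<in> J"
      by blast
    moreover from this have "K \<in> tuples (J - {i})"
      by (subst tuples_insert_head[of i J K \<nu>, symmetric]) (simp_all only: add x(2))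
    ultimately show "?remove x \<in> ?B"
      by (simp add: remove)
    show "?add (?remove x) = x"
      unfolding remove unfolding x(1) prod.case add ..
    show "(case ?remove x of (i, I, \<nu>) \<Rightarrow> F (I(\<nu> := i # I \<nu>)) \<nu>) = (case x of (I, \<nu>) \<Rightarrow> F I \<nu>)"
      unfolding remove unfolding x(1) prod.case add ..
  qed (auto simp: tuples_insert_head)
  also have "\<dots> = (\<Sum>i\<in>J. \<Sum>(I, \<nu>)\<in>tuples (J - {i}) \<times> UNIV. F (I(\<nu> := i # I \<nu>)) \<nu>)"
    by (rule sum.Sigma[symmetric]) (simp_all add: assms(1) finite_tuples)
  also have "\<dots> = (\<Sum>i\<in>J. \<Sum>I\<in>tuples (J - {i}). \<Sum>\<nu>\<in>UNIV. F (I(\<nu> := i # I \<nu>)) \<nu>)"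
    by (simp add: sum.cartesian_product)
  finally show ?thesis .
qed

text \<open>
  The hypothesis on \<open>\<gamma>\<close> is the regularity along \<open>t\<^sub>i = \<infinity>\<close>: the tuples with \<open>i\<close> at a first place
  are those whose component is only of order \<open>1 / t\<^sub>i\<close>, and the leading terms cancel.
\<close>

lemma primitive_sum_mobius_invariant:
  fixes \<theta> :: "('i, 'n::finite) pvar \<Rightarrow> 'a::field"
    and \<gamma> :: "('n \<Rightarrow> 'i list) \<Rightarrow> 'a"
  assumes J: "finite J" and \<theta>: "inj \<theta>"
    and D: "a * d - b * c \<noteq> 0" and nz: "\<And>v. c * \<theta> v + d \<noteq> 0"
    and prim: "\<And>i I. i \<in> J \<Longrightarrow> I \<in> tuples (J - {i}) \<Longrightarrow> (\<Sum>\<nu>\<in>UNIV. \<gamma> (I(\<nu> := i # I \<nu>))) = 0"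
  shows "(\<Sum>I\<in>tuples J. \<gamma> I * tuple_value (\<lambda>v. mobius a b c d (\<theta> v)) I) *
      (\<Prod>i\<in>J. (a * d - b * c) / (c * \<theta> (T i) + d) ^ 2)
    = (\<Sum>I\<in>tuples J. \<gamma> I * tuple_value \<theta> I)"
proof -
  let ?t = "\<lambda>I \<nu>. top_value \<theta> \<nu> (I \<nu>)" and ?z = "\<lambda>\<nu>. \<theta> (Z \<nu>)"
  let ?F = "\<lambda>I \<nu>. \<gamma> I * (c * (?z \<nu> - ?t I \<nu>) / (c * ?t I \<nu> + d) *
    (\<Prod>\<mu>\<in>UNIV - {\<nu>}. (?z \<mu> - ?t I \<nu>) / (?t I \<mu> - ?t I \<nu>))) * tuple_value \<theta> I"
  have top: "\<exists>v. ?t I \<nu> = \<theta> v \<and> v \<in> insert (Z \<nu>) (T ` set (I \<nu>))" for I :: "'n \<Rightarrow> 'i list" and \<nu>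
    by (cases "I \<nu>") (auto simp: top_value_def)
  have nz_top: "c * ?t I \<nu> + d \<noteq> 0" for I \<nu>
    using top[of \<nu> I] nz by auto
  have inj_top: "inj (?t I)" if "I \<in> tuples J" for I
  proof (rule injI)
    fix \<mu> \<nu> assume "?t I \<mu> = ?t I \<nu>"
    then obtain v where "v \<in> insert (Z \<mu>) (T ` set (I \<mu>))" "v \<in> insert (Z \<nu>) (T ` set (I \<nu>))"
      using top[of \<mu> I] top[of \<nu> I] \<theta> by (metis injD)
    then show "\<mu> = \<nu>"
      using that by (fastforce simp: tuples_def disjoint_family_on_def)
  qed
  have "(\<Sum>I\<in>tuples J. \<gamma> I * tuple_value (\<lambda>v. mobius a b c d (\<theta> v)) I) *
      (\<Prod>i\<in>J. (a * d - b * c) / (c * \<theta> (T i) + d) ^ 2)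
    = (\<Sum>I\<in>tuples J. \<gamma> I *
        ((\<Prod>\<nu>\<in>UNIV. (c * ?z \<nu> + d) / (c * ?t I \<nu> + d)) * tuple_value \<theta> I))"
    unfolding sum_distrib_right
  proof (intro sum.cong refl)
    fix I :: "'n \<Rightarrow> 'i list" assume "I \<in> tuples J"
    from tuple_value_mobius[where \<theta> = \<theta>, OF D nz this]
    show "\<gamma> I * tuple_value (\<lambda>v. mobius a b c d (\<theta> v)) I *
        (\<Prod>i\<in>J. (a * d - b * c) / (c * \<theta> (T i) + d) ^ 2)
      = \<gamma> I * ((\<Prod>\<nu>\<in>UNIV. (c * ?z \<nu> + d) / (c * ?t I \<nu> + d)) * tuple_value \<theta> I)"
      by (simp only: mult.assoc)
  qed
  also have "\<dots> = (\<Sum>I\<in>tuples J. \<gamma> I * tuple_value \<theta> I + (\<Sum>\<nu>\<in>UNIV. ?F I \<nu>))"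
  proof (intro sum.cong refl)
    fix I :: "'n \<Rightarrow> 'i list" assume I: "I \<in> tuples J"
    have "(\<Prod>\<nu>\<in>UNIV. (c * ?z \<nu> + d) / (c * ?t I \<nu> + d))
        = 1 + (\<Sum>\<nu>\<in>UNIV. c * (?z \<nu> - ?t I \<nu>) / (c * ?t I \<nu> + d) *
            (\<Prod>\<mu>\<in>UNIV - {\<nu>}. (?z \<mu> - ?t I \<nu>) / (?t I \<mu> - ?t I \<nu>)))"
      by (rule prod_mobius_partial_fractions) (simp_all add: inj_top[OF I] nz_top)
    then show "\<gamma> I * ((\<Prod>\<nu>\<in>UNIV. (c * ?z \<nu> + d) / (c * ?t I \<nu> + d)) * tuple_value \<theta> I)
        = \<gamma> I * tuple_value \<theta> I + (\<Sum>\<nu>\<in>UNIV. ?F I \<nu>)"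
      by (simp only: distrib_left distrib_right mult_1_left sum_distrib_left sum_distrib_right
          mult.assoc)
  qed
  also have "\<dots> = (\<Sum>I\<in>tuples J. \<gamma> I * tuple_value \<theta> I) + (\<Sum>I\<in>tuples J. \<Sum>\<nu>\<in>UNIV. ?F I \<nu>)"
    by (rule sum.distrib)
  also have "(\<Sum>I\<in>tuples J. \<Sum>\<nu>\<in>UNIV. ?F I \<nu>)
      = (\<Sum>i\<in>J. \<Sum>I\<in>tuples (J - {i}). \<Sum>\<nu>\<in>UNIV. ?F (I(\<nu> := i # I \<nu>)) \<nu>)"
    by (rule sum_tuples_by_head) (simp_all add: J top_value_def)
  also have "\<dots> = 0"
  proof (rule sum.neutral, rule ballI, rule sum.neutral, rule ballI)
    fix i and I :: "'n \<Rightarrow> 'i list" assume i: "i \<in> J" and I: "I \<in> tuples (J - {i})"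
    let ?x = "\<theta> (T i)"
    \<comment> \<open>The common factor of all terms with the given \<open>i\<close> and \<open>I\<close>; it does not involve the place where \<open>i\<close> is put.\<close>
    let ?w = "- c / (c * ?x + d) * tuple_value \<theta> I * (\<Prod>\<mu>\<in>UNIV. (?z \<mu> - ?x) / (?t I \<mu> - ?x))"
    have "?F (I(\<nu> := i # I \<nu>)) \<nu> = \<gamma> (I(\<nu> := i # I \<nu>)) * ?w" for \<nu>
    proof -
      have x: "?t (I(\<nu> := i # I \<nu>)) \<nu> = ?x"
        by (simp add: top_value_def)
      have other: "(\<Prod>\<mu>\<in>UNIV - {\<nu>}. (?z \<mu> - ?x) / (?t (I(\<nu> := i # I \<nu>)) \<mu> - ?x))
          = (\<Prod>\<mu>\<in>UNIV - {\<nu>}. (?z \<mu> - ?x) / (?t I \<mu> - ?x))"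
        by (intro prod.cong) auto
      have sign: "tuple_value \<theta> I / (?x - ?t I \<nu>) = - (tuple_value \<theta> I / (?t I \<nu> - ?x))"
        by (metis minus_diff_eq minus_divide_right)
      obtain P where P: "(\<Prod>\<mu>\<in>UNIV - {\<nu>}. (?z \<mu> - ?x) / (?t I \<mu> - ?x)) = P"
        by blast
      have all: "(\<Prod>\<mu>\<in>UNIV. (?z \<mu> - ?x) / (?t I \<mu> - ?x)) = (?z \<nu> - ?x) / (?t I \<nu> - ?x) * P"
        unfolding P[symmetric] by (rule prod.remove) simp_all
      show ?thesis
        unfolding x other P all tuple_value_add_head sign by simp
    qed
    then have "(\<Sum>\<nu>\<in>UNIV. ?F (I(\<nu> := i # I \<nu>)) \<nu>) = (\<Sum>\<nu>\<in>UNIV. \<gamma> (I(\<nu> := i # I \<nu>))) * ?w"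
      by (simp only: sum_distrib_right)
    then show "(\<Sum>\<nu>\<in>UNIV. ?F (I(\<nu> := i # I \<nu>)) \<nu>) = 0"
      using prim[OF i I] by simp
  qed
  finally show ?thesis by simp
qed

section \<open>Automorphisms of the projective line\<close>

lemma degree_le_1_imp: "degree p \<le> 1 \<Longrightarrow> p = [:coeff p 0, coeff p 1:]"
  by (intro poly_eqI) (auto simp: coeff_pCons coeff_eq_0 split: nat.split)

lemma const_divide: "const (a / b) = const a / const b"
proof (cases "b = 0")
  case False
  then have "const (a / b) * const b = const a"
    by (simp flip: const_mult)
  with False show ?thesis
    by (simp add: eq_divide_eq const_eq_0_iff)
qed (simp add: const_0)

lemma linear_var_neq_0:
  assumes "a * d - b * c \<noteq> 0"
  shows "const c * var v + const d \<noteq> 0"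
proof
  assume *: "const c * var v + const d = 0"
  have "c \<noteq> 0"
    using * assms by (auto simp: const_0 const_eq_0_iff)
  then have "var v = const c * var v / const c"
    by (simp add: const_eq_0_iff)
  also have "const c * var v = const (- d)"
    using * by (simp add: const_uminus eq_neg_iff_add_eq_0)
  finally have "var v = const (- d / c)"
    unfolding const_divide .
  then show False
    by (simp add: var_neq_const)
qed

text \<open>
  If the Wronskian vanishes, then \<open>q\<close> divides \<open>p q'\<close> and, being coprime to \<open>p\<close>, also its own
  derivative \<open>q'\<close>, so it is constant. Likewise \<open>p\<close> is constant; but a constant map is not injective.
\<close>

lemma inj_rat_map_imp_wronskian_neq_0:
  assumes "coprime p q" "inj (rat_map p q)"
  shows "pderiv p * q - p * pderiv q \<noteq> 0"
proof
  assume "pderiv p * q - p * pderiv q = 0"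
  then have eq: "pderiv p * q = p * pderiv q" by simp
  have "q dvd p * pderiv q"
    by (metis eq dvd_triv_right)
  then have "q dvd pderiv q"
    using assms(1) by (metis coprime_commute coprime_dvd_mult_right_iff)
  then have "degree q = 0"
    by simp
  have "p dvd pderiv p * q"
    by (metis eq dvd_triv_left)
  then have "p dvd pderiv p"
    using assms(1) by (metis coprime_dvd_mult_left_iff)
  then have "degree p = 0"
    by simp
  have "rat_map p q (Aff 0) = rat_map p q (Aff 1)"
    using \<open>degree p = 0\<close> \<open>degree q = 0\<close> by (auto simp: rat_map_def elim!: degree_eq_zeroE)
  with assms(2) show False
    by (simp add: inj_eq)
qed

lemma rat_map_Aff: "poly q x \<noteq> 0 \<Longrightarrow> rat_map p q (Aff x) = Aff (poly p x / poly q x)"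
  by (simp add: rat_map_def proj_point_def)

text \<open>
  The roots of \<open>p - l q\<close> are the affine points over \<open>l\<close>. By injectivity \<open>x\<close> is the only one, and
  if it were a multiple root then the Wronskian would vanish at \<open>x\<close>.
\<close>

lemma inj_rat_map_imp_degree_fibre_le_1:
  assumes "coprime p q" "inj (rat_map p q)"
    and W: "poly (pderiv p * q - p * pderiv q) x \<noteq> 0" and q: "poly q x \<noteq> 0"
  shows "degree (p - smult (poly p x / poly q x) q) \<le> 1"
proof (rule ccontr)
  define l where "l = poly p x / poly q x"
  define r where "r = p - smult l q"
  assume "\<not> degree (p - smult (poly p x / poly q x) q) \<le> 1"
  then have deg: "degree r > 1"
    by (simp add: r_def l_def)
  have "poly r x = 0"
    using q by (simp add: r_def l_def)
  then obtain s where s: "r = [:- x, 1:] * s"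
    by (auto simp: poly_eq_0_iff_dvd)
  have "s \<noteq> 0"
    using deg s by auto
  then have "degree r = Suc (degree s)"
    unfolding s by (subst degree_mult_eq) auto
  with deg have "degree s > 0"
    by simp
  then obtain y where y: "poly s y = 0"
    using alg_closed_imp_poly_has_root by blast
  show False
  proof (cases "y = x")
    case True
    have "pderiv r = [:- x, 1:] * pderiv s + s * pderiv [:- x, 1:]"
      unfolding s by (rule pderiv_mult)
    then have "poly (pderiv r) x = 0"
      using y True by simp
    then have "poly (pderiv p) x = l * poly (pderiv q) x"
      by (simp add: r_def pderiv_diff pderiv_smult)
    with W q show False
      by (simp add: l_def)
  next
    case False
    have "poly r y = 0"
      using y s by simp
    then have p: "poly p y = l * poly q y"
      by (simp add: r_def)
    have "poly q y \<noteq> 0"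
      using assms(1) p coprime_poly_0[of p q y] by auto
    then have "rat_map p q (Aff y) = rat_map p q (Aff x)"
      using p q by (simp add: rat_map_Aff l_def)
    with assms(2) False show False
      by (simp add: inj_eq)
  qed
qed

text \<open>
  Two fibres with different values \<open>l\<close> suffice, because \<open>p\<close> and \<open>q\<close> are linear combinations of the
  corresponding polynomials \<open>p - l q\<close>.
\<close>

lemma inj_rat_map_imp_degree_le_1:
  assumes "coprime p q" "inj (rat_map p q)"
  shows "degree p \<le> 1" "degree q \<le> 1"
proof -
  let ?W = "pderiv p * q - p * pderiv q"
  let ?l = "\<lambda>x. poly p x / poly q x"
  have "?W \<noteq> 0"
    by (rule inj_rat_map_imp_wronskian_neq_0[OF assms])
  then have "q \<noteq> 0"
    by auto
  with \<open>?W \<noteq> 0\<close> have fin: "finite {x. poly (?W * q) x = 0}"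
    by (intro poly_roots_finite) simp
  have ex: "\<exists>x. x \<notin> F \<and> poly ?W x \<noteq> 0 \<and> poly q x \<noteq> 0" if F: "finite F" for F
  proof -
    obtain x where "x \<notin> F \<union> {x. poly (?W * q) x = 0}"
      using ex_new_if_finite[OF infinite_UNIV_char_0 finite_UnI[OF F fin]] by blast
    then show ?thesis
      by (intro exI[of _ x]) simp
  qed
  obtain x where x: "poly ?W x \<noteq> 0" "poly q x \<noteq> 0"
    using ex[of "{}"] by auto
  obtain y where y: "y \<noteq> x" "poly ?W y \<noteq> 0" "poly q y \<noteq> 0"
    using ex[of "{x}"] by auto
  have "?l x \<noteq> ?l y"
    using injD[OF assms(2), of "Aff x" "Aff y"] y(1) by (auto simp: rat_map_Aff x y)
  have px: "degree (p - smult (?l x) q) \<le> 1"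
    by (rule inj_rat_map_imp_degree_fibre_le_1[OF assms x])
  have py: "degree (p - smult (?l y) q) \<le> 1"
    by (rule inj_rat_map_imp_degree_fibre_le_1[OF assms y(2,3)])
  have "smult (?l y - ?l x) q = (p - smult (?l x) q) - (p - smult (?l y) q)"
    by (simp add: smult_diff_left)
  then have "degree (smult (?l y - ?l x) q) \<le> 1"
    using degree_diff_le[OF px py] by metis
  with \<open>?l x \<noteq> ?l y\<close> show q: "degree q \<le> 1"
    by simp
  have "degree ((p - smult (?l x) q) + smult (?l x) q) \<le> 1"
    by (intro degree_add_le px order.trans[OF degree_smult_le q])
  then show "degree p \<le> 1"
    by simp
qed

lemma Aut_P_morphism_rep:
  assumes "g \<in> Aut_P"
  obtains a b c d where "morphism_rep g = ([:b, a:], [:d, c:])" "a * d - b * c \<noteq> 0"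
proof -
  have "\<exists>r. (\<lambda>(p, q). coprime p q \<and> g = rat_map p q) r"
    using assms by (auto simp: Aut_P_def proj_morphism_def)
  then have "(\<lambda>(p, q). coprime p q \<and> g = rat_map p q) (morphism_rep g)"
    unfolding morphism_rep_def by (rule someI_ex)
  then obtain p q where rep: "morphism_rep g = (p, q)" and pq: "coprime p q" "g = rat_map p q"
    by (cases "morphism_rep g") auto
  then have inj: "inj (rat_map p q)"
    using assms by (auto simp: Aut_P_def bij_def)
  note deg = inj_rat_map_imp_degree_le_1[OF pq(1) inj]
  obtain a b c d where abcd: "p = [:b, a:]" "q = [:d, c:]"
    using deg[THEN degree_le_1_imp] by blast
  have "a * d - b * c \<noteq> 0"
    using inj_rat_map_imp_wronskian_neq_0[OF pq(1) inj]
    by (auto simp: abcd pderiv_pCons algebra_simps)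
  with rep abcd show ?thesis
    by (intro that) auto
qed

lemma poly_map_const_linear: "poly (map_poly const [:b, a:]) f = const a * f + const b"
  by (simp add: map_poly_pCons const_0 mult.commute add.commute)

lemma morphism_at_linear:
  assumes "morphism_rep g = ([:b, a:], [:d, c:])"
  shows "morphism_at g f = (const a * f + const b) / (const c * f + const d)"
  by (simp add: morphism_at_def eval_quot_def assms poly_map_const_linear del: map_poly_pCons)

lemma morphism_deriv_at_linear:
  assumes "morphism_rep g = ([:b, a:], [:d, c:])"
  shows "morphism_deriv_at g f = const (a * d - b * c) / (const c * f + const d) ^ 2"
proof -
  have num: "pderiv [:b, a:] * [:d, c:] - [:b, a:] * pderiv [:d, c:] = [:a * d - b * c:]"
    by (simp add: pderiv_pCons algebra_simps)
  have "const 2 = const (1 + 1)"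
    by simp
  then have two: "const 2 = 2"
    unfolding const_add const_1 by simp
  have "[:d, c:] ^ 2 = [:d * d, c * d + c * d, c * c:]"
    by (simp add: power2_eq_square algebra_simps)
  then have den: "poly (map_poly const ([:d, c:] ^ 2)) f = (const c * f + const d) ^ 2"
    by (simp add: map_poly_pCons const_0 const_add const_mult two power2_eq_square algebra_simps)
  show ?thesis
    unfolding morphism_deriv_at_def eval_quot_def assms prod.case num den
    by (simp add: map_poly_pCons const_0)
qed

section \<open>Coefficients of invariant polydifferentials\<close>

text \<open>
  A possibly infinite linear combination of the \<open>\<zeta>\<^sub>I\<close>, with the coefficientwise sum already
  reduced to the finitely many tuples that matter on \<open>J\<close>.
\<close>

definition combination :: "(('n \<Rightarrow> 'i list) \<Rightarrow> complex) \<Rightarrow> ('i::countable, 'n::finite) polydiff"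
  where "combination c = (\<lambda>J. \<Sum>I\<in>tuples J. const (c I) * tuple_value var I)"

lemma Sum_any_zeta_tuple:
  "(\<lambda>J. Sum_any (\<lambda>I. const (c I) * zeta_tuple I J)) = combination c"
proof
  fix J
  show "Sum_any (\<lambda>I. const (c I) * zeta_tuple I J) = combination c J"
  proof (cases "finite J")
    case True
    then have "Sum_any (\<lambda>I. const (c I) * zeta_tuple I J)
        = (\<Sum>I\<in>tuples J. const (c I) * zeta_tuple I J)"
      by (intro Sum_any.expand_superset finite_tuples) (auto simp: zeta_tuple_eq)
    then show ?thesis
      by (simp add: combination_def zeta_tuple_eq)
  next
    case False
    then show ?thesis
      by (simp add: combination_def zeta_tuple_eq tuples_infinite)
  qed
qed

lemma combination_0: "combination (\<lambda>_. 0) = 0"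
  by (auto simp: combination_def fun_eq_iff const_0)

lemma combination_add: "combination c + combination c' = combination (\<lambda>I. c I + c' I)"
  by (auto simp: combination_def fun_eq_iff const_add distrib_right sum.distrib)

lemma combination_scale: "scale a (combination c) = combination (\<lambda>I. a * c I)"
  by (auto simp: combination_def fun_eq_iff scale_def const_mult sum_distrib_left mult.assoc)

lemma combination_sum: "(\<Sum>x\<in>A. combination (c x)) = combination (\<lambda>I. \<Sum>x\<in>A. c x I)"
  by (induction A rule: infinite_finite_induct) (simp_all add: combination_0 combination_add)

lemma combination_eqD:
  assumes "combination c = combination c'" "I \<in> tuples J"
  shows "c I = c' I"
proof -
  have "finite J"
    using assms(2) tuples_infinite by blast
  have "combination (\<lambda>I. c I - c' I) J = combination c J - combination c' J"
    by (simp add: combination_def const_diff left_diff_distrib sum_subtractf)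
  then have "(\<Sum>I\<in>tuples J. const (c I - c' I) * tuple_value var I) = 0"
    using fun_cong[OF assms(1), of J] by (simp add: combination_def)
  from tuple_values_independent[OF \<open>finite J\<close> this assms(2)] show ?thesis
    by simp
qed

lemma Bhat_imp_combination:
  assumes "\<omega> \<in> Bhat"
  shows "\<exists>c D. (\<forall>I. c I \<noteq> 0 \<longrightarrow> (\<Sum>\<nu>\<in>UNIV. length (I \<nu>)) \<le> D) \<and> \<omega> = combination c"
  using assms unfolding Bhat_def
proof (induction \<omega> rule: polydiff.span_induct_alt)
  case base
  show ?case
    by (intro exI[of _ "\<lambda>_. 0"]) (auto simp: combination_0)
next
  case (step a x y)
  then obtain c c' D D' where
    c: "\<And>I. c I \<noteq> 0 \<Longrightarrow> (\<Sum>\<nu>\<in>UNIV. length (I \<nu>)) = D" "x = combination c" and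
    c': "\<And>I. c' I \<noteq> 0 \<Longrightarrow> (\<Sum>\<nu>\<in>UNIV. length (I \<nu>)) \<le> D'" "y = combination c'"
    by (auto simp: Bhat_deg_def Sum_any_zeta_tuple)
  have "(\<Sum>\<nu>\<in>UNIV. length (I \<nu>)) \<le> max D D'" if "a * c I + c' I \<noteq> 0" for I
    using c(1)[of I] c'(1)[of I] that by (cases "c I = 0") auto
  moreover have "scale a x + y = combination (\<lambda>I. a * c I + c' I)"
    by (simp add: c(2) c'(2) combination_scale combination_add)
  ultimately show ?case
    by (intro exI[of _ "\<lambda>I. a * c I + c' I"] exI[of _ "max D D'"]) simp
qed

definition colors :: "('i \<Rightarrow> 'k) \<Rightarrow> ('n \<Rightarrow> 'i list) \<Rightarrow> 'n \<Rightarrow> 'k list"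
  where "colors \<pi> I = (\<lambda>\<nu>. map \<pi> (I \<nu>))"

lemma zeta_eq_combination: "zeta \<pi> S = combination (\<lambda>I. if colors \<pi> I = S then 1 else 0)"
proof -
  have "zeta \<pi> S
      = (\<lambda>J. Sum_any (\<lambda>I. const (if colors \<pi> I = S then 1 else 0) * zeta_tuple I J))"
    unfolding zeta_def
    by (intro ext arg_cong[where f = Sum_any]) (auto simp: colors_def fun_eq_iff const_1 const_0)
  then show ?thesis
    by (simp add: Sum_any_zeta_tuple)
qed

lemma permute_combination:
  fixes c :: "('n::finite \<Rightarrow> 'i::countable list) \<Rightarrow> complex"
  assumes "bij \<sigma>"
  shows "permute \<sigma> (combination c) = combination (\<lambda>I. c (\<lambda>\<nu>. map (inv \<sigma>) (I \<nu>)))"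
proof
  fix J
  let ?\<theta> = "\<lambda>v. var (case v of T i \<Rightarrow> T (\<sigma> i) | Z \<nu> \<Rightarrow> Z \<nu>) :: ('i, 'n) ratfun"
  have "inj ?\<theta>"
    using assms by (auto simp: inj_def var_eq_iff bij_def split: pvar.splits)
  have \<theta>: "tuple_value ?\<theta> I = tuple_value var (\<lambda>\<nu>. map \<sigma> (I \<nu>))" for I :: "'n \<Rightarrow> 'i list"
    by (simp add: tuple_value_def chain_value_def o_def)
  have tuples_map: "(\<lambda>\<nu>. map \<tau> (I \<nu>)) \<in> tuples (\<tau> ` K)"
    if "bij \<tau>" "I \<in> tuples K" for \<tau> :: "'i \<Rightarrow> 'i" and I :: "'n \<Rightarrow> 'i list" and K
    using that by (auto simp: tuples_def distinct_map bij_def disjoint_family_on_def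
        image_Int[symmetric] intro: inj_on_subset)
  have "permute \<sigma> (combination c) J
      = (\<Sum>I\<in>tuples (inv \<sigma> ` J). const (c I) * tuple_value ?\<theta> I)"
    unfolding permute_def combination_def
    by (intro subst_eqI evaluates_sum evaluates_mult evaluates_const evaluates_tuple_value
        \<open>inj ?\<theta>\<close>)
  also have "\<dots> = (\<Sum>I\<in>tuples J. const (c (\<lambda>\<nu>. map (inv \<sigma>) (I \<nu>))) * tuple_value var I)"
  proof (rule sum.reindex_bij_witness[where i = "\<lambda>I \<nu>. map (inv \<sigma>) (I \<nu>)"
        and j = "\<lambda>I \<nu>. map \<sigma> (I \<nu>)"])
    fix I :: "'n \<Rightarrow> 'i list" assume "I \<in> tuples (inv \<sigma> ` J)"
    from tuples_map[OF assms this] show "(\<lambda>\<nu>. map \<sigma> (I \<nu>)) \<in> tuples J"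
      using assms by (simp add: image_image bij_is_surj surj_f_inv_f)
  next
    fix I :: "'n \<Rightarrow> 'i list" assume "I \<in> tuples J"
    then show "(\<lambda>\<nu>. map (inv \<sigma>) (I \<nu>)) \<in> tuples (inv \<sigma> ` J)"
      by (intro tuples_map bij_imp_bij_inv assms)
  qed (use assms in \<open>simp_all add: o_def bij_is_surj bij_is_inj surj_f_inv_f inv_f_f \<theta>\<close>)
  finally show "permute \<sigma> (combination c) J = combination (\<lambda>I. c (\<lambda>\<nu>. map (inv \<sigma>) (I \<nu>))) J"
    by (simp add: combination_def)
qed

text \<open>
  Entry by entry: a permutation that is right for the tails is corrected by a transposition of two
  indices of the same colour, which does not move the tails.
\<close>

lemma ex_color_perm_list:
  assumes "length xs = length ys" "distinct xs" "distinct ys" "map \<pi> xs = map \<pi> ys"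
  shows "\<exists>\<sigma>\<in>color_perms \<pi>. map \<sigma> xs = ys"
  using assms
proof (induction xs ys rule: list_induct2)
  case Nil
  then show ?case
    by (auto simp: color_perms_def intro!: exI[of _ id])
next
  case (Cons x xs y ys)
  then obtain \<sigma> where \<sigma>: "bij \<sigma>" "\<And>i. \<pi> (\<sigma> i) = \<pi> i" "map \<sigma> xs = ys"
    by (auto simp: color_perms_def)
  let ?\<tau> = "transpose (\<sigma> x) y \<circ> \<sigma>"
  have "\<sigma> x \<notin> set ys"
    using Cons.prems \<sigma>(1,3) by (auto simp: bij_def inj_eq)
  moreover have "y \<notin> set ys"
    using Cons.prems by simp
  ultimately have "map (transpose (\<sigma> x) y) ys = ys"
    by (intro map_idI) (auto simp: transpose_def)
  then have "map ?\<tau> xs = ys"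
    by (simp only: map_map[symmetric] \<sigma>(3))
  then have "map ?\<tau> (x # xs) = y # ys"
    by simp
  moreover have "bij ?\<tau>"
    by (intro bij_comp \<sigma>(1) bij_transpose)
  moreover have "\<pi> (\<sigma> x) = \<pi> y"
    using \<sigma>(2)[of x] Cons.prems(3) by simp
  then have "\<pi> (transpose (\<sigma> x) y j) = \<pi> j" for j
    by (auto simp: transpose_def)
  then have "\<pi> (?\<tau> i) = \<pi> i" for i
    by (simp only: o_apply \<sigma>(2))
  ultimately show ?case
    by (intro bexI[of _ ?\<tau>]) (simp_all only: color_perms_def mem_Collect_eq simp_thms)
qed

text \<open>
  Concatenating the members reduces this to a single sequence; the lengths of the members allow
  one to cut it up again.
\<close>

lemma ex_color_perm_tuple:
  fixes I I' :: "'n::finite \<Rightarrow> 'i list"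
  assumes "I \<in> tuples J" "I' \<in> tuples J'" "colors \<pi> I = colors \<pi> I'"
  shows "\<exists>\<sigma>\<in>color_perms \<pi>. (\<lambda>\<nu>. map \<sigma> (I \<nu>)) = I'"
proof -
  obtain ns :: "'n list" where ns: "set ns = UNIV" "distinct ns"
    using finite_distinct_list[OF finite_UNIV] by blast
  have dist: "distinct (concat (map K ms))" if "K \<in> tuples L" "distinct ms"
    for K :: "'n \<Rightarrow> 'i list" and L ms
  proof -
    have disj: "set (K \<mu>) \<inter> set (K \<nu>) = {}" if "\<mu> \<noteq> \<nu>" for \<mu> \<nu>
      using \<open>K \<in> tuples L\<close> that by (simp add: tuples_def disjoint_family_on_def)
    have "distinct (K \<nu>)" for \<nu>
      using \<open>K \<in> tuples L\<close> by (simp add: tuples_def)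
    moreover have "set (K \<mu>) \<inter> (\<Union>\<nu>\<in>set ks. set (K \<nu>)) = {}" if "\<mu> \<notin> set ks" for \<mu> ks
    proof (rule ccontr)
      assume "set (K \<mu>) \<inter> (\<Union>\<nu>\<in>set ks. set (K \<nu>)) \<noteq> {}"
      then obtain x \<nu> where x: "x \<in> set (K \<mu>)" "\<nu> \<in> set ks" "x \<in> set (K \<nu>)"
        by blast
      then have "\<mu> \<noteq> \<nu>"
        using that by metis
      from disj[OF this] x show False
        by (simp add: disjoint_iff)
    qed
    ultimately show ?thesis
      using \<open>distinct ms\<close> by (induction ms) simp_all
  qed
  have col: "map \<pi> (I \<nu>) = map \<pi> (I' \<nu>)" for \<nu>
    using assms(3) by (simp add: colors_def fun_eq_iff)
  then have len: "length (I \<nu>) = length (I' \<nu>)" for \<nu>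
    by (metis length_map)
  have col': "map \<pi> (concat (map I ns)) = map \<pi> (concat (map I' ns))"
    by (simp add: map_concat o_def col)
  then have "length (concat (map I ns)) = length (concat (map I' ns))"
    by (metis length_map)
  from ex_color_perm_list[OF this dist[OF assms(1) ns(2)] dist[OF assms(2) ns(2)] col']
  obtain \<sigma> where \<sigma>: "\<sigma> \<in> color_perms \<pi>" "map \<sigma> (concat (map I ns)) = concat (map I' ns)"
    by blast
  then have "concat (map (\<lambda>\<nu>. map \<sigma> (I \<nu>)) ns) = concat (map I' ns)"
    by (simp add: map_concat o_def)
  then have "map (\<lambda>\<nu>. map \<sigma> (I \<nu>)) ns = map I' ns"
    by (subst (asm) concat_eq_concat_iff) (auto simp: zip_map_map zip_same_conv_map len)
  then have "map \<sigma> (I \<nu>) = I' \<nu>" for \<nu>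
    using ns(1) by (simp add: map_eq_conv)
  with \<sigma>(1) show ?thesis
    by blast
qed

lemma ex_distinct_list_of_colors:
  assumes "\<And>k. infinite (\<pi> -` {k})" "finite F"
  shows "\<exists>xs. distinct xs \<and> map \<pi> xs = s \<and> set xs \<inter> F = {}"
proof (induction s)
  case (Cons k s)
  then obtain xs where xs: "distinct xs" "map \<pi> xs = s" "set xs \<inter> F = {}"
    by blast
  have "infinite (\<pi> -` {k} - (F \<union> set xs))"
    using assms by simp
  then obtain x where "x \<in> \<pi> -` {k} - (F \<union> set xs)"
    using infinite_imp_nonempty by blast
  with xs show ?case
    by (intro exI[of _ "x # xs"]) auto
qed simp

text \<open>
  As the fibres are infinite, every colour is available outside the finitely many indices already
  used.
\<close>

lemma ex_tuple_of_colors: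
  fixes S :: "'n::finite \<Rightarrow> 'k list"
  assumes "\<And>k. infinite (\<pi> -` {k})"
  shows "\<exists>I. (\<exists>J. I \<in> tuples J) \<and> colors \<pi> I = S"
proof -
  have "\<exists>I. (\<forall>\<nu>\<in>N. distinct (I \<nu>) \<and> map \<pi> (I \<nu>) = S \<nu>) \<and> disjoint_family_on (\<lambda>\<nu>. set (I \<nu>)) N"
    if "finite N" for N
    using that
  proof (induction N)
    case empty
    then show ?case by (simp add: disjoint_family_on_def)
  next
    case (insert \<kappa> N)
    then obtain I where I: "\<forall>\<nu>\<in>N. distinct (I \<nu>) \<and> map \<pi> (I \<nu>) = S \<nu>"
      "disjoint_family_on (\<lambda>\<nu>. set (I \<nu>)) N"
      by blast
    have "finite (\<Union>\<nu>\<in>N. set (I \<nu>))"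
      using insert.hyps by simp
    from ex_distinct_list_of_colors[OF assms this]
    obtain xs where xs: "distinct xs" "map \<pi> xs = S \<kappa>" "set xs \<inter> (\<Union>\<nu>\<in>N. set (I \<nu>)) = {}"
      by blast
    have "disjoint_family_on (\<lambda>\<nu>. set ((I(\<kappa> := xs)) \<nu>)) (insert \<kappa> N)"
      using I(2) xs(3) insert.hyps(2) by (fastforce simp: disjoint_family_on_def)
    with I(1) xs(1,2) show ?case
      by (intro exI[of _ "I(\<kappa> := xs)"]) auto
  qed
  from this[OF finite_UNIV] obtain I where
    "\<forall>\<nu>. distinct (I \<nu>) \<and> map \<pi> (I \<nu>) = S \<nu>" "disjoint_family (\<lambda>\<nu>. set (I \<nu>))"
    by auto
  then show ?thesis
    by (intro exI[of _ I] conjI exI[of _ "\<Union>\<nu>. set (I \<nu>)"]) (auto simp: tuples_def colors_def)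
qed

lemma invariant_coefficients:
  fixes c :: "('n::finite \<Rightarrow> 'i::countable list) \<Rightarrow> complex"
  assumes "\<And>\<sigma>. \<sigma> \<in> color_perms \<pi> \<Longrightarrow> permute \<sigma> (combination c) = combination c"
    and "I \<in> tuples J" "I' \<in> tuples J'" "colors \<pi> I = colors \<pi> I'"
  shows "c I = c I'"
proof -
  from ex_color_perm_tuple[OF assms(2-4)]
  obtain \<sigma> where \<sigma>: "\<sigma> \<in> color_perms \<pi>" "(\<lambda>\<nu>. map \<sigma> (I \<nu>)) = I'"
    by (rule bexE)
  then have "bij \<sigma>"
    by (simp add: color_perms_def)
  then have "combination (\<lambda>K. c (\<lambda>\<nu>. map (inv \<sigma>) (K \<nu>))) = combination c"
    using assms(1)[OF \<sigma>(1)] by (simp add: permute_combination)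
  from combination_eqD[OF this assms(3)]
  have "c (\<lambda>\<nu>. map (inv \<sigma>) (map \<sigma> (I \<nu>))) = c I'"
    unfolding \<sigma>(2)[symmetric] .
  then show ?thesis
    using \<open>bij \<sigma>\<close> by (simp add: o_def bij_is_inj inv_f_f)
qed

text \<open>
  A coefficient function that depends only on colours is determined at every colour tuple, because
  each of them is realised by a tuple of indices.
\<close>

lemma combination_colors_eqD:
  fixes C C' :: "('n::finite \<Rightarrow> 'k list) \<Rightarrow> complex"
  assumes "\<And>k. infinite (\<pi> -` {k})"
    and "combination (\<lambda>I. C (colors \<pi> I)) = combination (\<lambda>I. C' (colors \<pi> I))"
  shows "C = C'"
proof
  fix S :: "'n \<Rightarrow> 'k list"
  from ex_tuple_of_colors[OF assms(1), of S]
  obtain I where "(\<exists>J. I \<in> tuples J) \<and> colors \<pi> I = S"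
    by (rule exE)
  then have ex: "\<exists>J. I \<in> tuples J" and S: "colors \<pi> I = S"
    by simp_all
  from ex obtain J where "I \<in> tuples J"
    by (rule exE)
  have "C (colors \<pi> I) = C' (colors \<pi> I)"
    by (rule combination_eqD[OF assms(2) \<open>I \<in> tuples J\<close>])
  then show "C S = C' S"
    by (simp only: S)
qed

lemma sum_scale_zeta:
  assumes "finite A"
  shows "(\<Sum>S\<in>A. scale (a S) (zeta \<pi> S))
    = combination (\<lambda>I. if colors \<pi> I \<in> A then a (colors \<pi> I) else 0)"
proof -
  have "(\<Sum>S\<in>A. a S * (if colors \<pi> I = S then 1 else 0))
      = (if colors \<pi> I \<in> A then a (colors \<pi> I) else 0)" for I
    using assms by (simp add: if_distrib[of "\<lambda>x. _ * x"] cong: if_cong)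
  then show ?thesis
    by (simp add: zeta_eq_combination combination_scale combination_sum)
qed

lemma inj_zeta:
  assumes "\<And>k. infinite (\<pi> -` {k})"
  shows "inj (zeta \<pi> :: ('n::finite \<Rightarrow> 'k list) \<Rightarrow> ('i::countable, 'n) polydiff)"
proof (rule injI)
  fix S S' :: "'n \<Rightarrow> 'k list"
  assume "(zeta \<pi> S :: ('i, 'n) polydiff) = zeta \<pi> S'"
  from combination_colors_eqD[OF assms this[unfolded zeta_eq_combination]]
  have "(\<lambda>K. if K = S then 1 else 0 :: complex) = (\<lambda>K. if K = S' then 1 else 0)" .
  from fun_cong[OF this, of S] show "S = S'"
    by (simp split: if_splits)
qed

text \<open>
  Together with \<open>inj_zeta\<close> this makes the coordinates used by \<open>e_comp\<close> meaningful: with respect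
  to a dependent set, \<open>polydiff.representation\<close> is zero by default.
\<close>

lemma independent_zeta:
  assumes "\<And>k. infinite (\<pi> -` {k})"
  shows "\<not> polydiff.dependent
    (range (zeta \<pi> :: ('n::finite \<Rightarrow> 'k list) \<Rightarrow> ('i::countable, 'n) polydiff))"
  unfolding polydiff.independent_explicit_module
proof (intro allI impI)
  fix B u and v :: "('i, 'n) polydiff"
  assume B: "finite B" "B \<subseteq> range (zeta \<pi>)" "(\<Sum>v\<in>B. scale (u v) v) = 0" "v \<in> B"
  obtain A :: "('n \<Rightarrow> 'k list) set" where A: "finite A" "B = zeta \<pi> ` A"
    using finite_subset_image[OF B(1,2)] by blast
  have "inj_on (zeta \<pi> :: _ \<Rightarrow> ('i, 'n) polydiff) A"
    using inj_zeta[OF assms] by (rule inj_on_subset) simp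
  then have "(\<Sum>S\<in>A. scale (u (zeta \<pi> S)) (zeta \<pi> S)) = 0"
    using B(3) by (simp add: A(2) sum.reindex)
  then have "combination (\<lambda>I. if colors \<pi> I \<in> A then u (zeta \<pi> (colors \<pi> I)) else 0)
      = combination (\<lambda>_. 0)"
    using sum_scale_zeta[OF A(1), of "\<lambda>S. u (zeta \<pi> S)" \<pi>] by (simp add: combination_0)
  from combination_colors_eqD[OF assms this]
  have "(\<lambda>S. if S \<in> A then u (zeta \<pi> S) else 0) = (\<lambda>_. 0)" .
  from fun_cong[OF this] show "u v = 0"
    using B(4) A(2) by (metis imageE)
qed

text \<open>
  There are finitely many colours and the degrees are bounded, so an invariant element is a finite
  combination of the elements \<open>zeta \<pi> S\<close>.
\<close>

lemma Bhat_invariants_imp_combination: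
  fixes \<pi> :: "'i::countable \<Rightarrow> 'k::finite" and \<omega> :: "('i, 'n::finite) polydiff"
  assumes "\<And>k. infinite (\<pi> -` {k})" "\<omega> \<in> Bhat_invariants \<pi>"
  obtains C where "finite {S. C S \<noteq> 0}" "\<omega> = combination (\<lambda>I. C (colors \<pi> I))"
proof -
  obtain c D where c: "\<And>I. c I \<noteq> 0 \<Longrightarrow> (\<Sum>\<nu>\<in>UNIV. length (I \<nu>)) \<le> D" and \<omega>: "\<omega> = combination c"
    using assms(2) Bhat_imp_combination[of \<omega>] unfolding Bhat_invariants_def by blast
  have inv: "\<sigma> \<in> color_perms \<pi> \<Longrightarrow> permute \<sigma> (combination c) = combination c" for \<sigma>
    using assms(2) \<omega> by (simp add: Bhat_invariants_def)
  have "\<forall>S :: 'n \<Rightarrow> 'k list. \<exists>I :: 'n \<Rightarrow> 'i list. (\<exists>J. I \<in> tuples J) \<and> colors \<pi> I = S"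
    by (rule allI, rule ex_tuple_of_colors[OF assms(1)])
  then obtain r :: "('n \<Rightarrow> 'k list) \<Rightarrow> 'n \<Rightarrow> 'i list"
    where r: "\<exists>J. r S \<in> tuples J" "colors \<pi> (r S) = S" for S
    by metis
  show ?thesis
  proof (rule that)
    show "finite {S. c (r S) \<noteq> 0}"
    proof (rule finite_subset)
      have len: "length (S \<nu>) \<le> D" if "c (r S) \<noteq> 0" for S \<nu>
      proof -
        have "length (S \<nu>) = length (r S \<nu>)"
          using fun_cong[OF r(2)[of S], of \<nu>] unfolding colors_def by (metis length_map)
        also have "\<dots> \<le> (\<Sum>\<nu>\<in>UNIV. length (r S \<nu>))"
          by (rule member_le_sum) auto
        also have "\<dots> \<le> D"
          by (rule c[OF that])
        finally show ?thesis .
      qed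
      then show "{S. c (r S) \<noteq> 0} \<subseteq> PiE UNIV (\<lambda>_. {s. set s \<subseteq> UNIV \<and> length s \<le> D})"
        by (auto simp: PiE_UNIV_domain)
      show "finite (PiE (UNIV :: 'n set) (\<lambda>_. {s :: 'k list. set s \<subseteq> UNIV \<and> length s \<le> D}))"
        by (intro finite_PiE finite_lists_length_le) auto
    qed
    have "c I = c (r (colors \<pi> I))" if "I \<in> tuples J" for I J
    proof -
      from r(1)[of "colors \<pi> I"] obtain J' where "r (colors \<pi> I) \<in> tuples J'"
        by (rule exE)
      from invariant_coefficients[where \<pi> = \<pi>, OF inv that this] show ?thesis
        by (simp only: r(2))
    qed
    then show "\<omega> = combination (\<lambda>I. c (r (colors \<pi> I)))"
      unfolding \<omega> by (auto simp: combination_def fun_eq_iff intro!: sum.cong)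
  qed
qed

lemma representation_zeta:
  fixes \<pi> :: "'i::countable \<Rightarrow> 'k" and C :: "('n::finite \<Rightarrow> 'k list) \<Rightarrow> complex"
  assumes inf: "\<And>k. infinite (\<pi> -` {k})" and fin: "finite {S. C S \<noteq> 0}"
  shows "polydiff.representation (range (zeta \<pi>)) (combination (\<lambda>I. C (colors \<pi> I))) (zeta \<pi> S) = C S"
proof -
  let ?zeta = "zeta \<pi> :: ('n \<Rightarrow> 'k list) \<Rightarrow> ('i, 'n) polydiff"
  let ?f = "\<lambda>b. if b \<in> range ?zeta then C (inv ?zeta b) else 0"
  note inj = inj_zeta[OF inf, where 'n = 'n]
  have "(\<lambda>I. if colors \<pi> I \<in> {S. C S \<noteq> 0} then C (colors \<pi> I) else 0) = (\<lambda>I. C (colors \<pi> I))"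
    by auto
  with sum_scale_zeta[OF fin, of C \<pi>]
  have eq: "(\<Sum>S | C S \<noteq> 0. scale (C S) (?zeta S)) = combination (\<lambda>I. C (colors \<pi> I))"
    by simp
  have supp: "{b. ?f b \<noteq> 0} = ?zeta ` {S. C S \<noteq> 0}"
    by (auto simp: inv_f_f[OF inj] dest: injD[OF inj])
  have "polydiff.representation (range ?zeta) (combination (\<lambda>I. C (colors \<pi> I))) = ?f"
  proof (rule polydiff.representation_eqI)
    show "\<not> polydiff.dependent (range ?zeta)"
      by (rule independent_zeta[OF inf])
    show "combination (\<lambda>I. C (colors \<pi> I)) \<in> polydiff.span (range ?zeta)"
      unfolding eq[symmetric]
      by (intro polydiff.span_sum polydiff.span_scale polydiff.span_base rangeI)
    show "finite {b. ?f b \<noteq> 0}"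
      unfolding supp using fin by simp
    have "(\<Sum>b | ?f b \<noteq> 0. scale (?f b) b) = (\<Sum>S | C S \<noteq> 0. scale (?f (?zeta S)) (?zeta S))"
      unfolding supp by (subst sum.reindex) (use inj in \<open>auto intro: inj_on_subset\<close>)
    also have "\<dots> = (\<Sum>S | C S \<noteq> 0. scale (C S) (?zeta S))"
      by (simp add: inv_f_f[OF inj])
    finally show "(\<Sum>b | ?f b \<noteq> 0. scale (?f b) b) = combination (\<lambda>I. C (colors \<pi> I))"
      using eq by simp
  qed (auto split: if_splits)
  then show ?thesis
    by (simp add: inv_f_f[OF inj])
qed

text \<open>
  Removing a first letter \<open>k\<close> from basis elements amounts to reading off the coefficient with \<open>k\<close> put
  in front.
\<close>

lemma e_comp_combination:
  fixes \<pi> :: "'i::countable \<Rightarrow> 'k" and C :: "('n::finite \<Rightarrow> 'k list) \<Rightarrow> complex"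
  assumes inf: "\<And>k. infinite (\<pi> -` {k})" and fin: "finite {S. C S \<noteq> 0}"
  shows "e_comp \<pi> k \<nu> (combination (\<lambda>I. C (colors \<pi> I)))
    = combination (\<lambda>I. C ((colors \<pi> I)(\<nu> := k # colors \<pi> I \<nu>)))"
proof -
  let ?add = "\<lambda>S :: 'n \<Rightarrow> 'k list. S(\<nu> := k # S \<nu>)"
  let ?remove = "\<lambda>S :: 'n \<Rightarrow> 'k list. S(\<nu> := tl (S \<nu>))"
  let ?A = "{S. C S \<noteq> 0 \<and> (\<exists>s. S \<nu> = k # s)}"
  let ?A' = "{S. C (?add S) \<noteq> 0}"
  let ?e = "\<lambda>S. e_basis \<pi> k \<nu> S :: ('i, 'n) polydiff"
  have undo: "S(\<nu> := k # s) = S" if "S \<nu> = k # s" for S :: "'n \<Rightarrow> 'k list" and s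
    using that by (simp add: fun_eq_iff)
  have "finite ?A"
    by (rule finite_subset[OF _ fin]) auto
  have img: "?A' = ?remove ` ?A"
  proof (intro equalityI subsetI)
    fix S assume "S \<in> ?A'"
    then show "S \<in> ?remove ` ?A"
      by (intro image_eqI[where x = "?add S"]) simp_all
  next
    fix S assume "S \<in> ?remove ` ?A"
    then obtain R s where R: "S = ?remove R" "C R \<noteq> 0" "R \<nu> = k # s"
      by auto
    then have "?add S = R"
      by (simp add: undo)
    with R(2) show "S \<in> ?A'"
      by simp
  qed
  have e_0: "?e S = 0" if "\<nexists>s. S \<nu> = k # s" for S
    using that by (auto simp: e_basis_def split: list.split)
  have e: "?e S = zeta \<pi> (?remove S)" if "S \<in> ?A" for S
    using that by (auto simp: e_basis_def)
  have "e_comp \<pi> k \<nu> (combination (\<lambda>I. C (colors \<pi> I))) = Sum_any (\<lambda>S. scale (C S) (?e S))"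
    unfolding e_comp_def representation_zeta[OF inf fin] ..
  also have "\<dots> = (\<Sum>S\<in>?A. scale (C S) (?e S))"
    using e_0 by (intro Sum_any.expand_superset \<open>finite ?A\<close>) auto
  also have "\<dots> = (\<Sum>S\<in>?A'. scale (C (?add S)) (zeta \<pi> S))"
    by (rule sum.reindex_bij_witness[where i = ?add and j = ?remove]) (auto simp: e undo)
  also have "\<dots> = combination (\<lambda>I. if colors \<pi> I \<in> ?A' then C (?add (colors \<pi> I)) else 0)"
    by (rule sum_scale_zeta) (simp add: img \<open>finite ?A\<close>)
  also have "(\<lambda>I. if colors \<pi> I \<in> ?A' then C (?add (colors \<pi> I)) else 0)
      = (\<lambda>I. C (?add (colors \<pi> I)))"
    by auto
  finally show ?thesis .
qed

text \<open>
  The coefficient of \<open>zeta \<pi> S\<close> in the image under the operator of colour \<open>k\<close> is the sum of the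
  coefficients of the colour tuples obtained from \<open>S\<close> by putting \<open>k\<close> in front of one member.
\<close>

lemma primitive_part_coefficients:
  fixes \<pi> :: "'i::countable \<Rightarrow> 'k::finite" and \<omega> :: "('i, 'n::finite) polydiff"
  assumes inf: "\<And>k. infinite (\<pi> -` {k})" and "\<omega> \<in> primitive_part \<pi>"
  obtains c where "\<omega> = combination c" "\<forall>i I. (\<Sum>\<nu>\<in>UNIV. c (I(\<nu> := i # I \<nu>))) = 0"
proof -
  obtain C where C: "finite {S. C S \<noteq> 0}" "\<omega> = combination (\<lambda>I. C (colors \<pi> I))"
    using assms Bhat_invariants_imp_combination unfolding primitive_part_def by blast
  have e: "(\<Sum>\<nu>\<in>UNIV. C (S(\<nu> := k # S \<nu>))) = 0" for k and S :: "'n \<Rightarrow> 'k list"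
  proof -
    have "e_op \<pi> k \<omega> = combination (\<lambda>I. \<Sum>\<nu>\<in>UNIV. C ((colors \<pi> I)(\<nu> := k # colors \<pi> I \<nu>)))"
      by (simp add: e_op_def C(2) e_comp_combination[OF inf C(1)] combination_sum)
    moreover have "e_op \<pi> k \<omega> = 0"
      using assms(2) by (simp add: primitive_part_def)
    ultimately have "combination (\<lambda>I. \<Sum>\<nu>\<in>UNIV. C ((colors \<pi> I)(\<nu> := k # colors \<pi> I \<nu>)))
        = (combination (\<lambda>I. 0) :: ('i, 'n) polydiff)"
      by (simp add: combination_0)
    from combination_colors_eqD[OF inf this]
    have "(\<lambda>S. \<Sum>\<nu>\<in>UNIV. C (S(\<nu> := k # S \<nu>))) = (\<lambda>_. 0)" .
    then show ?thesis
      by (rule fun_cong)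
  qed
  show ?thesis
  proof (rule that)
    show "\<omega> = combination (\<lambda>I. C (colors \<pi> I))"
      by (rule C(2))
    show "\<forall>i I. (\<Sum>\<nu>\<in>UNIV. C (colors \<pi> (I(\<nu> := i # I \<nu>)))) = 0"
    proof (intro allI)
      fix i and I :: "'n \<Rightarrow> 'i list"
      have "colors \<pi> (I(\<nu> := i # I \<nu>)) = (colors \<pi> I)(\<nu> := \<pi> i # colors \<pi> I \<nu>)" for \<nu>
        by (auto simp: colors_def)
      then show "(\<Sum>\<nu>\<in>UNIV. C (colors \<pi> (I(\<nu> := i # I \<nu>)))) = 0"
        by (simp add: e)
    qed
  qed
qed

theorem theorem2p15:
  fixes \<pi> :: "'i::countable \<Rightarrow> 'k::finite"
    and \<omega> :: "('i, 'n::finite) polydiff"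
    and g :: "proj_line \<Rightarrow> proj_line"
  assumes "surj \<pi>"
    and "\<And>k. infinite (\<pi> -` {k})"
    and "\<omega> \<in> primitive_part \<pi>"
    and "g \<in> Aut_P"
  shows "pullback g \<omega> = \<omega>"
proof
  fix J
  obtain \<gamma> where \<omega>: "\<omega> = combination \<gamma>"
    and prim: "\<forall>i I. (\<Sum>\<nu>\<in>UNIV. \<gamma> (I(\<nu> := i # I \<nu>))) = 0"
    by (rule primitive_part_coefficients[OF assms(2,3)]) (rule that)
  obtain a b c d where g: "morphism_rep g = ([:b, a:], [:d, c:])" and D: "a * d - b * c \<noteq> 0"
    by (rule Aut_P_morphism_rep[OF assms(4)])
  let ?m = "mobius (const a) (const b) (const c) (const d) :: ('i, 'n) ratfun \<Rightarrow> _"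
  let ?\<theta> = "\<lambda>v. ?m (var v)"
  have D': "const a * const d - const b * const c \<noteq> (0 :: ('i, 'n) ratfun)"
    using D by (simp add: const_eq_0_iff flip: const_mult const_diff)
  have nz: "const c * var v + const d \<noteq> (0 :: ('i, 'n) ratfun)" for v
    by (rule linear_var_neq_0[OF D])
  have \<theta>: "morphism_at g (var v) = ?\<theta> v" for v
    by (simp add: morphism_at_linear[OF g] mobius_def)
  have "inj ?\<theta>"
  proof (rule injI)
    fix u v assume "?\<theta> u = ?\<theta> v"
    then have "var u - var v = (0 :: ('i, 'n) ratfun)"
      using mobius_diff[OF nz nz, of "const a" "const b" u v] D' nz by simp
    then show "u = v"
      by (simp add: var_eq_iff)
  qed
  show "pullback g \<omega> J = \<omega> J"
  proof (cases "finite J")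
    case True
    have "subst ?\<theta> (\<omega> J) = (\<Sum>I\<in>tuples J. const (\<gamma> I) * tuple_value ?\<theta> I)"
      unfolding \<omega> combination_def
      by (intro subst_eqI evaluates_sum evaluates_mult evaluates_const evaluates_tuple_value
          \<open>inj ?\<theta>\<close>)
    then have "pullback g \<omega> J = (\<Sum>I\<in>tuples J. const (\<gamma> I) * tuple_value ?\<theta> I) *
        (\<Prod>i\<in>J. (const a * const d - const b * const c) / (const c * var (T i) + const d) ^ 2)"
      by (simp only: pullback_def \<theta> morphism_deriv_at_linear[OF g] const_diff const_mult)
    also have "\<dots> = (\<Sum>I\<in>tuples J. const (\<gamma> I) * tuple_value var I)"
      using prim by (intro primitive_sum_mobius_invariant True inj_var D' nz)
        (simp add: const_0 flip: const_sum)
    finally show ?thesis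
      by (simp add: \<omega> combination_def)
  next
    case False
    then have "\<omega> J = 0"
      by (simp add: \<omega> combination_def tuples_infinite)
    moreover have "subst ?\<theta> 0 = 0"
      by (rule subst_eqI[OF evaluates_0])
    ultimately show ?thesis
      by (simp add: pullback_def \<theta>)
  qed
qed

end
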